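(* Let $\mathbb{H}$ be the Heisenberg group with its subriemannian (Carnot-Carathéodory) metric. Then $\mathbb{H}$ does not admit a bilipschitz embedding of a thick family of geodesics; that is, if $M$ is a metric space containing a thick family of geodesics, then there is no bilipschitz embedding of $M$ into $\mathbb{H}$.
   Context: Heisenberg group. $\mathbb{H}$ is $\mathbb{R}^3$ with the group law $(x,y,z)\cdot(x',y',z')=(x+x',\,y+y',\,z+z'+\tfrac12(xy'-yx'))$. An absolutely continuous curve $\gamma=(x,y,z):[a,b]\to\mathbb{R}^3$ is horizontal if $\dot z=\tfrac12(x\dot y-y\dot x)$ almost everywhere; its length is $\int_a^b\sqrt{\dot x^2+\dot y^2}\,dt$. The subriemannian (Carnot-Carathéodory) distance between two points of $\mathbb{H}$ is the infimum of the lengths of horizontal curves joining them. Geodesics. Let $u,v$ be two elements of a metric space $(M,d_M)$. A $uv$-geodesic is a distance-preserving map $g:[0,d_M(u,v)]\to M$ with $g(0)=u$ and $g(d_M(u,v))=v$ (the interval carries the usual distance of $\mathbb{R}$). Thick family of geodesics. A nonempty family $T$ of $uv$-geodesics in $M$ (for fixed $u,v\in M$) is called thick if there is $\alpha>0$ such that for every $g\in T$ and every finite collection of points $r_1,\dots,r_n\in[0,d_M(u,v)]$ there are another $uv$-geodesic $\widetilde g\in T$ and a sequence $0<s_1<q_1<s_2<q_2<\dots<s_m<q_m<s_{m+1}<d_M(u,v)$ satisfying: (i) the set $\{0,q_1,\dots,q_m,d_M(u,v)\}$ contains $r_1,\dots,r_n$; (ii) $g(q_i)=\widetilde g(q_i)$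 for $i=1,\dots,m$; (iii) $\sum_{i=1}^{m+1}d_M(g(s_i),\widetilde g(s_i))\ge\alpha$. A metric space contains a thick family of geodesics if for some $u,v$ in it there is a thick family of $uv$-geodesics. Bilipschitz embedding. A map $F:(M,d_M)\to(X,d_X)$ is a bilipschitz embedding if there are constants $0<c\le C<\infty$ with $c\,d_M(x,y)\le d_X(F(x),F(y))\le C\,d_M(x,y)$ for all $x,y\in M$. *)

theory Defs
  imports "HOL-Analysis.Analysis"
begin

section \<open>The Heisenberg group with its Carnot-Caratheodory distance\<close>

type_synonym heis = "real \<times> real \<times> real"

fun heis_mult :: "heis \<Rightarrow> heis \<Rightarrow> heis" where
  "heis_mult (x, y, z) (x', y', z') = (x + x', y + y', z + z' + (x * y' - y * x') / 2)"

text \<open>The finite set \<open>D\<close> is a finite family of nonoverlapping closed subintervals \<open>[Inf K, Sup K]\<close>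
  of \<open>[a, b]\<close> (library notion \<^const>\<open>division_of\<close>; the intervals need not cover \<open>[a, b]\<close>).\<close>

definition abs_continuous_on :: "real \<Rightarrow> real \<Rightarrow> (real \<Rightarrow> 'a::metric_space) \<Rightarrow> bool" where
  "abs_continuous_on a b f \<longleftrightarrow>
    (\<forall>\<epsilon>>0. \<exists>\<delta>>0. \<forall>D. D division_of \<Union>D \<longrightarrow> \<Union>D \<subseteq> {a..b} \<longrightarrow> (\<Sum>K\<in>D. Sup K - Inf K) < \<delta> \<longrightarrow>
      (\<Sum>K\<in>D. dist (f (Inf K)) (f (Sup K))) < \<epsilon>)"

text \<open>The values of a curve outside \<open>[a, b]\<close> are irrelevant. An absolutely continuous curve is
  differentiable almost everywhere, so asking for the derivative to exist at almost every \<open>t\<close> is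
  no restriction.\<close>

definition horizontal_curve :: "real \<Rightarrow> real \<Rightarrow> (real \<Rightarrow> heis) \<Rightarrow> bool" where
  "horizontal_curve a b \<gamma> \<longleftrightarrow> a \<le> b \<and> abs_continuous_on a b \<gamma> \<and>
    (AE t in lebesgue_on {a..b}. \<exists>x y z x' y' z'.
      \<gamma> t = (x, y, z) \<and> (\<gamma> has_vector_derivative (x', y', z')) (at t within {a..b}) \<and>
      z' = (x * y' - y * x') / 2)"

text \<open>For absolutely continuous \<open>\<gamma>\<close> the integrand below is Lebesgue integrable.\<close>

definition heis_length :: "real \<Rightarrow> real \<Rightarrow> (real \<Rightarrow> heis) \<Rightarrow> real" where
  "heis_length a b \<gamma> =
    (LINT t|lebesgue_on {a..b}.
      (case vector_derivative \<gamma> (at t within {a..b}) of (x', y', z') \<Rightarrow> sqrt (x'\<^sup>2 + y'\<^sup>2)))"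

text \<open>Any two points are joined by a horizontal curve, so the infimum is over a nonempty set of
  nonnegative reals.\<close>

definition heis_dist :: "heis \<Rightarrow> heis \<Rightarrow> real" where
  "heis_dist p q =
    Inf {heis_length a b \<gamma> | a b \<gamma>. horizontal_curve a b \<gamma> \<and> \<gamma> a = p \<and> \<gamma> b = q}"

text \<open>The group law enters the metric through left translations, which are isometries.\<close>

lemma heis_mult_affine:
  "heis_mult (x, y, z) w = (x, y, z) + (fst w, fst (snd w), snd (snd w) + (x * fst (snd w) - y * fst w) / 2)"
  by (cases w) simp

lemma heis_mult_inverse: "heis_mult p (heis_mult (- p) w) = w"
  by (cases p; cases w) (simp add: field_simps)

lemma heis_mult_inverse': "heis_mult (- p) (heis_mult p w) = w"
  using heis_mult_inverse[of "- p" w] by simp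

lemma bounded_linear_heis_shear:
  "bounded_linear (\<lambda>w :: heis. (fst w, fst (snd w), snd (snd w) + (x * fst (snd w) - y * fst w) / 2))"
  by (intro linear_conv_bounded_linear[THEN iffD1] linearI) (auto simp: field_simps)

lemma heis_mult_has_vector_derivative:
  assumes "(\<gamma> has_vector_derivative (x', y', z')) F"
  shows "((\<lambda>t. heis_mult (x, y, z) (\<gamma> t)) has_vector_derivative
    (x', y', z' + (x * y' - y * x') / 2)) F"
  unfolding heis_mult_affine
  using has_vector_derivative_add[OF has_vector_derivative_const
      bounded_linear.has_vector_derivative[OF bounded_linear_heis_shear[of x y] assms],
      of "(x, y, z)"]
  by simp

lemma abs_continuous_on_heis_mult:
  assumes "abs_continuous_on a b \<gamma>"
  shows "abs_continuous_on a b (\<lambda>t. heis_mult p (\<gamma> t))"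
proof -
  obtain x y z where p: "p = (x, y, z)" by (cases p)
  define L :: "heis \<Rightarrow> heis" where
    "L = (\<lambda>w. (fst w, fst (snd w), snd (snd w) + (x * fst (snd w) - y * fst w) / 2))"
  have L: "bounded_linear L" unfolding L_def by (rule bounded_linear_heis_shear)
  obtain B where B: "B > 0" "\<And>w. norm (L w) \<le> norm w * B"
    using bounded_linear.pos_bounded[OF L] by blast
  have d: "dist (heis_mult p v) (heis_mult p w) \<le> B * dist v w" for v w
  proof -
    have "dist (heis_mult p v) (heis_mult p w) = norm (L (v - w))"
      unfolding p heis_mult_affine dist_norm by (simp add: L_def diff_divide_distrib algebra_simps)
    with B(2)[of "v - w"] show ?thesis by (simp add: dist_norm mult.commute)
  qed
  show ?thesis
    unfolding abs_continuous_on_def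
  proof (intro allI impI)
    fix \<epsilon> :: real assume "\<epsilon> > 0"
    with B(1) have "\<epsilon> / B > 0" by simp
    with assms obtain \<delta> where \<delta>: "\<delta> > 0"
      "\<And>D. D division_of \<Union>D \<Longrightarrow> \<Union>D \<subseteq> {a..b} \<Longrightarrow> (\<Sum>K\<in>D. Sup K - Inf K) < \<delta> \<Longrightarrow>
        (\<Sum>K\<in>D. dist (\<gamma> (Inf K)) (\<gamma> (Sup K))) < \<epsilon> / B"
      unfolding abs_continuous_on_def by meson
    show "\<exists>\<delta>>0. \<forall>D. D division_of \<Union>D \<longrightarrow> \<Union>D \<subseteq> {a..b} \<longrightarrow> (\<Sum>K\<in>D. Sup K - Inf K) < \<delta> \<longrightarrow>
      (\<Sum>K\<in>D. dist (heis_mult p (\<gamma> (Inf K))) (heis_mult p (\<gamma> (Sup K)))) < \<epsilon>"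
    proof (intro exI[of _ \<delta>] conjI allI impI \<delta>(1))
      fix D assume D: "D division_of \<Union>D" "\<Union>D \<subseteq> {a..b}" "(\<Sum>K\<in>D. Sup K - Inf K) < \<delta>"
      have "(\<Sum>K\<in>D. dist (heis_mult p (\<gamma> (Inf K))) (heis_mult p (\<gamma> (Sup K)))) \<le>
          (\<Sum>K\<in>D. B * dist (\<gamma> (Inf K)) (\<gamma> (Sup K)))"
        by (intro sum_mono d)
      also have "\<dots> < \<epsilon>"
        using \<delta>(2)[OF D] B(1) by (simp add: sum_distrib_left[symmetric] field_simps)
      finally show "(\<Sum>K\<in>D. dist (heis_mult p (\<gamma> (Inf K))) (heis_mult p (\<gamma> (Sup K)))) < \<epsilon>" .
    qed
  qed
qed

lemma horizontal_curve_heis_mult: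
  assumes "horizontal_curve a b \<gamma>"
  shows "horizontal_curve a b (\<lambda>t. heis_mult p (\<gamma> t))"
proof -
  obtain x y z where p: "p = (x, y, z)" by (cases p)
  have "AE t in lebesgue_on {a..b}. \<exists>x y z x' y' z'.
      \<gamma> t = (x, y, z) \<and> (\<gamma> has_vector_derivative (x', y', z')) (at t within {a..b}) \<and>
      z' = (x * y' - y * x') / 2"
    using assms by (simp add: horizontal_curve_def)
  then have "AE t in lebesgue_on {a..b}. \<exists>u v w x' y' z'.
      heis_mult p (\<gamma> t) = (u, v, w) \<and>
      ((\<lambda>t. heis_mult p (\<gamma> t)) has_vector_derivative (x', y', z')) (at t within {a..b}) \<and>
      z' = (u * y' - v * x') / 2"
  proof (rule eventually_mono, elim exE conjE)
    fix t u v w x' y' z'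
    assume t: "\<gamma> t = (u, v, w)" "(\<gamma> has_vector_derivative (x', y', z')) (at t within {a..b})"
      "z' = (u * y' - v * x') / 2"
    show "\<exists>u v w x' y' z'. heis_mult p (\<gamma> t) = (u, v, w) \<and>
      ((\<lambda>t. heis_mult p (\<gamma> t)) has_vector_derivative (x', y', z')) (at t within {a..b}) \<and>
      z' = (u * y' - v * x') / 2"
    proof (intro exI conjI)
      show "heis_mult p (\<gamma> t) = (x + u, y + v, z + w + (x * v - y * u) / 2)"
        using t(1) p by simp
      show "((\<lambda>t. heis_mult p (\<gamma> t)) has_vector_derivative
          (x', y', z' + (x * y' - y * x') / 2)) (at t within {a..b})"
        unfolding p by (rule heis_mult_has_vector_derivative[OF t(2)])
      show "z' + (x * y' - y * x') / 2 = ((x + u) * y' - (y + v) * x') / 2"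
        using t(3) by (simp add: field_simps)
    qed
  qed
  then show ?thesis
    using assms by (simp add: horizontal_curve_def abs_continuous_on_heis_mult)
qed

lemma heis_length_heis_mult: "heis_length a b (\<lambda>t. heis_mult p (\<gamma> t)) = heis_length a b \<gamma>"
  unfolding heis_length_def
proof (rule Bochner_Integration.integral_cong)
  fix t assume "t \<in> space (lebesgue_on {a..b})"
  then have t: "t \<in> {a..b}" by simp
  obtain x y z where p: "p = (x, y, z)" by (cases p)
  let ?F = "at t within {a..b}"
  have untranslate: "(\<gamma> has_vector_derivative (x', y', z' + (- x * y' - (- y) * x') / 2)) ?F"
    if "((\<lambda>t. heis_mult p (\<gamma> t)) has_vector_derivative (x', y', z')) ?F" for x' y' z'
    using heis_mult_has_vector_derivative[OF that, of "- x" "- y" "- z"] heis_mult_inverse'[of p]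
    by (simp add: p)
  show "(case vector_derivative (\<lambda>t. heis_mult p (\<gamma> t)) ?F of (x', y', z') \<Rightarrow> sqrt (x'\<^sup>2 + y'\<^sup>2)) =
    (case vector_derivative \<gamma> ?F of (x', y', z') \<Rightarrow> sqrt (x'\<^sup>2 + y'\<^sup>2))"
  proof (cases "a < b \<and> (\<exists>D. (\<gamma> has_vector_derivative D) ?F)")
    case True
    then obtain x' y' z' where D: "(\<gamma> has_vector_derivative (x', y', z')) ?F"
      by (metis prod_cases3)
    note D' = heis_mult_has_vector_derivative[OF D, of x y z]
    show ?thesis
      using True t vector_derivative_within_cbox[unfolded cbox_interval, OF _ _ D]
        vector_derivative_within_cbox[unfolded cbox_interval, OF _ _ D']
      by (simp add: p)
  next
    case False
    have "(\<lambda>D. ((\<lambda>t. heis_mult p (\<gamma> t)) has_vector_derivative D) ?F) =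
        (\<lambda>D. (\<gamma> has_vector_derivative D) ?F)"
    proof (cases "a < b")
      case True
      with False untranslate show ?thesis by (metis prod_cases3)
    next
      case notless: False
      with t have "{a..b} = {t}" by auto
      then have "?F = bot" by (simp only: at_within_def) simp
      then show ?thesis
        by (auto simp: has_vector_derivative_def has_derivative_def bounded_linear_scaleR_left)
    qed
    then have "vector_derivative (\<lambda>t. heis_mult p (\<gamma> t)) ?F = vector_derivative \<gamma> ?F"
      unfolding vector_derivative_def by metis
    then show ?thesis by simp
  qed
qed simp

lemma heis_dist_left_invariant: "heis_dist (heis_mult p v) (heis_mult p w) = heis_dist v w"
proof -
  define S where "S = (\<lambda>v w. {heis_length a b \<gamma> | a b \<gamma>. horizontal_curve a b \<gamma> \<and> \<gamma> a = v \<and> \<gamma> b = w})"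
  have sub: "S v w \<subseteq> S (heis_mult p v) (heis_mult p w)" for p v w
  proof
    fix l assume "l \<in> S v w"
    then obtain a b \<gamma> where g: "l = heis_length a b \<gamma>" "horizontal_curve a b \<gamma>" "\<gamma> a = v" "\<gamma> b = w"
      unfolding S_def by blast
    have "l = heis_length a b (\<lambda>t. heis_mult p (\<gamma> t))" using g(1) heis_length_heis_mult by simp
    with g horizontal_curve_heis_mult[OF g(2), of p] show "l \<in> S (heis_mult p v) (heis_mult p w)"
      unfolding S_def by blast
  qed
  have "S (heis_mult p v) (heis_mult p w) = S v w"
    using sub[of v w p] sub[of "heis_mult p v" "heis_mult p w" "- p"] by (auto simp: heis_mult_inverse')
  then show ?thesis by (simp add: heis_dist_def S_def)
qed


section \<open>Thick families of geodesics\<close>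

text \<open>Geodesics are total functions on \<^typ>\<open>real\<close>; only their values on \<open>[0, d u v]\<close> matter.\<close>

definition is_geodesic :: "'a set \<Rightarrow> ('a \<Rightarrow> 'a \<Rightarrow> real) \<Rightarrow> 'a \<Rightarrow> 'a \<Rightarrow> (real \<Rightarrow> 'a) \<Rightarrow> bool" where
  "is_geodesic M d u v g \<longleftrightarrow>
    g \<in> {0..d u v} \<rightarrow> M \<and> (\<forall>s\<in>{0..d u v}. \<forall>t\<in>{0..d u v}. d (g s) (g t) = \<bar>s - t\<bar>) \<and>
    g 0 = u \<and> g (d u v) = v"

definition thick_family ::
    "'a set \<Rightarrow> ('a \<Rightarrow> 'a \<Rightarrow> real) \<Rightarrow> 'a \<Rightarrow> 'a \<Rightarrow> (real \<Rightarrow> 'a) set \<Rightarrow> bool" where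
  "thick_family M d u v T \<longleftrightarrow>
    u \<in> M \<and> v \<in> M \<and> T \<noteq> {} \<and> (\<forall>g\<in>T. is_geodesic M d u v g) \<and>
    (\<exists>\<alpha>>0. \<forall>g\<in>T. \<forall>R. finite R \<and> R \<subseteq> {0..d u v} \<longrightarrow>
      (\<exists>g'\<in>T. g' \<noteq> g \<and> (\<exists>(m::nat) (s :: nat \<Rightarrow> real) (q :: nat \<Rightarrow> real).
        0 < s 1 \<and> (\<forall>i\<in>{1..m}. s i < q i \<and> q i < s (i + 1)) \<and> s (m + 1) < d u v \<and>
        R \<subseteq> {0, d u v} \<union> q ` {1..m} \<and>
        (\<forall>i\<in>{1..m}. g (q i) = g' (q i)) \<and>
        (\<Sum>i=1..m+1. d (g (s i)) (g' (s i))) \<ge> \<alpha>)))"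

definition contains_thick_family :: "'a set \<Rightarrow> ('a \<Rightarrow> 'a \<Rightarrow> real) \<Rightarrow> bool" where
  "contains_thick_family M d \<longleftrightarrow> (\<exists>u v T. thick_family M d u v T)"


section \<open>Bilipschitz embeddings\<close>

definition bilipschitz_embedding ::
    "'a set \<Rightarrow> ('a \<Rightarrow> 'a \<Rightarrow> real) \<Rightarrow> 'b set \<Rightarrow> ('b \<Rightarrow> 'b \<Rightarrow> real) \<Rightarrow> ('a \<Rightarrow> 'b) \<Rightarrow> bool" where
  "bilipschitz_embedding M dM X dX F \<longleftrightarrow> F \<in> M \<rightarrow> X \<and>
    (\<exists>c C. 0 < c \<and> c \<le> C \<and>
      (\<forall>x\<in>M. \<forall>y\<in>M. c * dM x y \<le> dX (F x) (F y) \<and> dX (F x) (F y) \<le> C * dM x y))"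

end

theory Submission
  imports Defs
begin

text \<open>Project the Lipschitz images of the geodesics of the thick family to the plane and measure them
  by the quadratic energy \<open>\<Sum> |f(t\<^sub>i\<^sub>+\<^sub>1) - f(t\<^sub>i)|\<^sup>2 / (t\<^sub>i\<^sub>+\<^sub>1 - t\<^sub>i)\<close> along partitions, which is bounded and increases
  under refinement. Choose a geodesic and a partition within \<open>\<epsilon>\<close> of the supremum, and let thickness
  provide a second geodesic meeting the first one at the points of a refinement. On every interval
  of that refinement both planar curves must then be nearly straight, since inserting a point of
  maximal deviation \<open>\<delta>\<close> from the chord of an interval of length \<open>l\<close> raises the energy by at least
  \<open>4 \<delta>\<^sup>2 / l\<close>. The height of a horizontal curve is the area swept by its projection, hence it is at
  most of order \<open>l * \<delta>\<close>, so the two curves stay within distance of order \<open>\<delta> + sqrt (l * \<delta>)\<close> on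
  the interval. Summing over the intervals gives a bound that tends to \<open>0\<close> with \<open>\<epsilon>\<close>, contradicting
  the lower bound \<open>c * \<alpha>\<close> from thickness and the bilipschitz condition.\<close>

section \<open>Absolutely continuous curves\<close>

lemma abs_continuous_on_subinterval:
  assumes "abs_continuous_on a b f" "{c..d} \<subseteq> {a..b}"
  shows "abs_continuous_on c d f"
  using assms unfolding abs_continuous_on_def by (meson order_trans)

text \<open>Absolute continuity speaks of untagged divisions, Henstock sums of tagged ones.
  Forgetting the tags loses no contribution: degenerate intervals contribute 0 and every other
  interval carries a single tag. All intervals lie in \<open>T\<close>, so their total length is at
  most the measure of \<open>T\<close>.\<close>

lemma abs_continuous_sum_tagged_less:
  assumes \<delta>: "\<And>D. D division_of \<Union>D \<Longrightarrow> \<Union>D \<subseteq> {a..b} \<Longrightarrow> (\<Sum>K\<in>D. Sup K - Inf K) < \<delta> \<Longrightarrow>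
      (\<Sum>K\<in>D. dist (f (Inf K)) (f (Sup K))) < (\<epsilon>::real)"
    and p: "p tagged_partial_division_of {a..b}"
    and T: "T \<in> lmeasurable" "measure lebesgue T < \<delta>" "\<And>x K. (x, K) \<in> p \<Longrightarrow> K \<subseteq> T"
  shows "(\<Sum>(x, K)\<in>p. dist (f (Inf K)) (f (Sup K))) < \<epsilon>"
proof -
  let ?D = "snd ` p"
  have D: "?D division_of \<Union>?D"
    by (rule partial_division_of_tagged_division[OF p])
  have sub: "\<Union>?D \<subseteq> {a..b}"
    using tagged_partial_division_ofD(3)[OF p] by fastforce
  have int: "\<exists>u v. K = {u..v} \<and> u \<le> v" if "K \<in> ?D" for K
  proof -
    obtain u v where "K = cbox u v" "K \<noteq> {}" using division_ofD(3,4)[OF D \<open>K \<in> ?D\<close>] by auto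
    then show ?thesis by auto
  qed
  have "(\<Sum>K\<in>?D. Sup K - Inf K) = (\<Sum>K\<in>?D. measure lebesgue K)"
    by (rule sum.cong) (use int in force)+
  also have "\<dots> = measure lebesgue (\<Union>?D)"
    by (rule content_division[OF D])
  also have "\<dots> \<le> measure lebesgue T"
    using T(3) lmeasurable_division[OF D] T(1)
    by (intro measure_mono_fmeasurable) (fastforce simp: fmeasurableD)+
  finally have small: "(\<Sum>K\<in>?D. Sup K - Inf K) < \<delta>" using T(2) by simp
  \<comment> \<open>\<open>sum.over_tagged_division_lemma\<close> wants 0 on every box with empty
    interior. This includes the empty box, whose \<open>Inf\<close> and \<open>Sup\<close> mean
    nothing, hence the case distinction.\<close>
  define g where "g = (\<lambda>K. if K = {} then 0 else dist (f (Inf K)) (f (Sup K)))"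
  have "(\<Sum>(x, K)\<in>p. dist (f (Inf K)) (f (Sup K))) = (\<Sum>(x, K)\<in>p. g K)"
    by (rule sum.cong) (use tagged_partial_division_ofD(2)[OF p] in \<open>force simp: g_def\<close>)+
  also have "\<dots> = (\<Sum>K\<in>?D. g K)"
    by (rule sum.over_tagged_division_lemma[OF tagged_partial_division_of_Union_self[OF p]])
      (auto simp: g_def)
  also have "\<dots> = (\<Sum>K\<in>?D. dist (f (Inf K)) (f (Sup K)))"
    by (rule sum.cong) (use int in \<open>force simp: g_def\<close>)+
  also have "\<dots> < \<epsilon>" by (rule \<delta>[OF D sub small])
  finally show ?thesis .
qed

text \<open>The tags in the exceptional null set are confined to an open set of small measure, where
  absolute continuity controls the increments of \<open>f\<close>. Thus the Henstock-Kurzweil integral gives the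
  fundamental theorem without any measurability argument.\<close>

theorem abs_continuous_has_integral:
  fixes f :: "real \<Rightarrow> 'a::banach"
  assumes "a \<le> b" and ac: "abs_continuous_on a b f" and N: "negligible N"
    and v: "\<And>x. x \<in> {a..b} - N \<Longrightarrow> (f has_vector_derivative v x) (at x within {a..b})"
  shows "(v has_integral (f b - f a)) {a..b}"
proof -
  define w where "w x = (if x \<in> N then 0 else v x)" for x
  have "(w has_integral (f b - f a)) {a..b}"
    unfolding has_integral_real
  proof (intro allI impI)
    fix e :: real assume "e > 0"
    \<comment> \<open>The errors of the good tags will add up to at most
      \<open>\<eta> * (b - a)\<close>; the summand 1 in the denominator covers
      \<open>a = b\<close>.\<close>
    define \<eta> where "\<eta> = e / (2 * (b - a + 1))"
    have \<eta>: "\<eta> > 0" "\<eta> * (b - a) < e / 2"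
      using \<open>e > 0\<close> \<open>a \<le> b\<close> by (auto simp: \<eta>_def divide_simps)
    have "\<forall>x. \<exists>d>0. x \<in> {a..b} - N \<longrightarrow>
         (\<forall>y\<in>{a..b}. norm (y-x) < d \<longrightarrow> norm (f y - f x - (y-x) *\<^sub>R v x) \<le> \<eta> * norm (y-x))"
      using v[unfolded has_vector_derivative_def has_derivative_within_alt] \<eta>(1)
      by (metis (no_types, lifting) zero_less_one)
    then obtain d where d: "\<And>x. 0 < d x"
      "\<And>x y. \<lbrakk>x \<in> {a..b} - N; y \<in> {a..b}; norm (y-x) < d x\<rbrakk>
        \<Longrightarrow> norm (f y - f x - (y-x) *\<^sub>R v x) \<le> \<eta> * norm (y-x)"
      by metis
    obtain \<delta> where \<delta>: "\<delta> > 0" "\<And>D. D division_of \<Union>D \<Longrightarrow> \<Union>D \<subseteq> {a..b} \<Longrightarrow>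
        (\<Sum>K\<in>D. Sup K - Inf K) < \<delta> \<Longrightarrow> (\<Sum>K\<in>D. dist (f (Inf K)) (f (Sup K))) < e / 2"
      using ac \<open>e > 0\<close> unfolding abs_continuous_on_def by (meson half_gt_zero)
    have Nnull: "N \<in> null_sets lebesgue" using N by (simp add: negligible_iff_null_sets)
    then obtain T where T: "open T" "N \<subseteq> T" "T - N \<in> lmeasurable" "emeasure lebesgue (T - N) < ennreal \<delta>"
      using sets_lebesgue_outer_open[OF null_setsD2 \<delta>(1)] by metis
    have Tm: "T \<in> lmeasurable" "measure lebesgue T < \<delta>"
    proof -
      have eq: "T = (T - N) \<union> N" using T(2) by auto
      have Nm: "N \<in> lmeasurable" "measure lebesgue N = 0"
        using N by (auto simp: negligible_imp_measurable negligible_imp_measure0)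
      show "T \<in> lmeasurable" using eq T(3) Nm(1) by (metis fmeasurable.Un)
      have "measure lebesgue T \<le> measure lebesgue (T - N) + measure lebesgue N"
        using eq measure_Un_le[of "T - N" lebesgue N] T(3) Nm(1) by (metis fmeasurableD)
      also have "\<dots> < \<delta>"
        using T(3,4) Nm(2) \<delta>(1) by (simp add: emeasure_eq_measure2 ennreal_less_iff)
      finally show "measure lebesgue T < \<delta>" .
    qed
    define G where "G x = (if x \<in> N then T else ball x (d x))" for x
    show "\<exists>\<gamma>. gauge \<gamma> \<and> (\<forall>p. p tagged_division_of {a..b} \<and> \<gamma> fine p \<longrightarrow>
        norm ((\<Sum>(x, K)\<in>p. measure lborel K *\<^sub>R w x) - (f b - f a)) < e)"
    proof (intro exI[of _ G] conjI allI impI; (elim conjE)?)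
      show "gauge G" using d(1) T(1,2) by (auto simp: G_def gauge_def)
      fix p assume p: "p tagged_division_of {a..b}" and fine: "G fine p"
      have finp: "finite p" using p by blast
      define R where "R = (\<lambda>(x, K). measure lborel K *\<^sub>R w x - (f (Sup K) - f (Inf K)))"
      define pN where "pN = {xK \<in> p. fst xK \<in> N}"
      have int: "\<exists>u v. K = {u..v} \<and> u \<le> x \<and> x \<le> v \<and> a \<le> u \<and> v \<le> b" if xK: "(x, K) \<in> p" for x K
      proof -
        obtain u v where "K = cbox u v" "x \<in> K" "K \<subseteq> {a..b}"
          using tagged_division_ofD(2-4)[OF p xK] by blast
        then show ?thesis by (intro exI[of _ u] exI[of _ v]) auto
      qed
      have "(\<Sum>(x, K)\<in>p. measure lborel K *\<^sub>R w x) - (f b - f a) = (\<Sum>xK\<in>p. R xK)"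
        unfolding R_def additive_tagged_division_1[OF \<open>a \<le> b\<close> p, of f, symmetric]
        by (simp add: sum_subtractf[symmetric] case_prod_unfold)
      also have "\<dots> = (\<Sum>xK\<in>p - pN. R xK) + (\<Sum>xK\<in>pN. R xK)"
        by (rule sum.subset_diff) (auto simp: pN_def finp)
      finally have split: "(\<Sum>(x, K)\<in>p. measure lborel K *\<^sub>R w x) - (f b - f a) =
          (\<Sum>xK\<in>p - pN. R xK) + (\<Sum>xK\<in>pN. R xK)" .
      have "norm (\<Sum>xK\<in>p - pN. R xK) \<le> (\<Sum>xK\<in>p - pN. \<eta> * (case xK of (x, K) \<Rightarrow> Sup K - Inf K))"
      proof (rule sum_norm_le)
        fix xK assume xK: "xK \<in> p - pN"
        obtain x K where xKeq: "xK = (x, K)" by (cases xK)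
        obtain s t where K: "K = {s..t}" "s \<le> x" "x \<le> t" "a \<le> s" "t \<le> b"
          using int[of x K] xK xKeq by auto
        have xN: "x \<notin> N" using xK xKeq by (auto simp: pN_def)
        have "K \<subseteq> ball x (d x)"
          using fine xK xKeq xN by (fastforce simp: fine_def G_def)
        then have "s \<in> ball x (d x)" "t \<in> ball x (d x)" unfolding K(1) using K(2,3) by (auto simp del: mem_ball)
        then have st: "norm (s - x) < d x" "norm (t - x) < d x"
          by (auto simp: dist_real_def)
        \<comment> \<open>Straddle argument: both endpoints are compared with the tag
          \<open>x\<close>, and the two errors add up to \<open>\<eta> * (t - s)\<close> because
          \<open>x\<close> lies between them.\<close>
        have "norm ((t - s) *\<^sub>R v x - (f t - f s)) =
            norm ((f s - f x - (s - x) *\<^sub>R v x) - (f t - f x - (t - x) *\<^sub>R v x))"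
          by (auto simp: algebra_simps)
        also have "\<dots> \<le> \<eta> * norm (s - x) + \<eta> * norm (t - x)"
          by (rule norm_triangle_le_diff) (intro add_mono d(2); use st K xN in auto)
        also have "\<dots> = \<eta> * (t - s)" using K by (simp add: algebra_simps)
        finally show "norm (R xK) \<le> \<eta> * (case xK of (x, K) \<Rightarrow> Sup K - Inf K)"
          using K xN by (simp add: R_def xKeq w_def)
      qed
      also have "\<dots> \<le> (\<Sum>xK\<in>p. \<eta> * (case xK of (x, K) \<Rightarrow> Sup K - Inf K))"
        by (rule sum_mono2) (use finp int \<eta>(1) in \<open>force intro!: mult_nonneg_nonneg\<close>)+
      also have "\<dots> = \<eta> * (b - a)"
        using additive_tagged_division_1[OF \<open>a \<le> b\<close> p, of "\<lambda>x. x"] by (simp flip: sum_distrib_left)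
      finally have 1: "norm (\<Sum>xK\<in>p - pN. R xK) < e / 2" using \<eta>(2) by simp
      have "norm (\<Sum>xK\<in>pN. R xK) \<le> (\<Sum>(x, K)\<in>pN. dist (f (Inf K)) (f (Sup K)))"
        by (rule sum_norm_le) (auto simp: R_def pN_def w_def dist_norm norm_minus_commute)
      also have "\<dots> < e / 2"
      proof (rule abs_continuous_sum_tagged_less[where f = f and a = a and b = b, OF \<delta>(2) _ Tm])
        have "p tagged_partial_division_of {a..b}" using p by (simp add: tagged_division_of_def)
        then show "pN tagged_partial_division_of {a..b}"
          by (rule tagged_partial_division_subset) (auto simp: pN_def)
        show "K \<subseteq> T" if "(x, K) \<in> pN" for x K
          using that fine by (fastforce simp: pN_def fine_def G_def)
      qed
      finally show "norm ((\<Sum>(x, K)\<in>p. measure lborel K *\<^sub>R w x) - (f b - f a)) < e"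
        unfolding split using 1 norm_triangle_ineq[of "\<Sum>xK\<in>p - pN. R xK" "\<Sum>xK\<in>pN. R xK"] by linarith
    qed
  qed
  then show ?thesis
    by (rule has_integral_spike[OF N, rotated]) (auto simp: w_def)
qed

text \<open>On an interval shorter than the \<open>\<delta>\<close> belonging to
  \<open>\<epsilon> = 1\<close>, the indefinite integral of \<open>v\<close>, which is
  \<open>f\<close> up to a constant, has variation at most 1. Bounded variation gives absolute
  integrability there, and finitely many such intervals cover \<open>[a, b]\<close>.\<close>

theorem abs_continuous_absolutely_integrable:
  fixes f :: "real \<Rightarrow> 'a::euclidean_space"
  assumes "a \<le> b" and ac: "abs_continuous_on a b f" and N: "negligible N"
    and v: "\<And>x. x \<in> {a..b} - N \<Longrightarrow> (f has_vector_derivative v x) (at x within {a..b})"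
  shows "v absolutely_integrable_on {a..b}"
proof -
  obtain \<delta> where \<delta>: "\<delta> > 0" "\<And>D. D division_of \<Union>D \<Longrightarrow> \<Union>D \<subseteq> {a..b} \<Longrightarrow>
      (\<Sum>K\<in>D. Sup K - Inf K) < \<delta> \<Longrightarrow> (\<Sum>K\<in>D. dist (f (Inf K)) (f (Sup K))) < 1"
    using ac unfolding abs_continuous_on_def by (meson zero_less_one)
  have integral: "(v has_integral (f d - f c)) {c..d}" if "c \<le> d" "{c..d} \<subseteq> {a..b}" for c d
  proof (rule abs_continuous_has_integral[OF \<open>c \<le> d\<close> abs_continuous_on_subinterval[OF ac that(2)] N])
    fix x assume x: "x \<in> {c..d} - N"
    show "(f has_vector_derivative v x) (at x within {c..d})"
      using has_vector_derivative_within_subset[OF v[of x] that(2)] x that(2) by auto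
  qed
  have short: "v absolutely_integrable_on {c..d}" if cd: "c \<le> d" "{c..d} \<subseteq> {a..b}" "d - c < \<delta>" for c d
  proof -
    have "v integrable_on cbox c d" using integral[OF cd(1,2)] by auto
    moreover have "(\<Sum>K\<in>D. norm (integral K v)) \<le> 1" if D: "D division_of cbox c d" for D
    proof -
      have int: "\<exists>s t. K = {s..t} \<and> s \<le> t \<and> K \<subseteq> {c..d}" if KD: "K \<in> D" for K
      proof -
        obtain s t where "K = cbox s t" "K \<noteq> {}" "K \<subseteq> cbox c d" using division_ofD(2-4)[OF D KD] by blast
        then show ?thesis by auto
      qed
      have "(\<Sum>K\<in>D. Sup K - Inf K) = (\<Sum>K\<in>D. measure lborel K)"
        by (rule sum.cong) (use int in force)+
      also have "\<dots> < \<delta>" using additive_content_division[OF D] cd by simp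
      finally have "(\<Sum>K\<in>D. dist (f (Inf K)) (f (Sup K))) < 1"
        by (intro \<delta>(2)) (use D cd(2) division_ofD(6)[OF D] in auto)
      moreover have "norm (integral K v) = dist (f (Inf K)) (f (Sup K))" if KD: "K \<in> D" for K
      proof -
        obtain s t where st: "K = {s..t}" "s \<le> t" "K \<subseteq> {c..d}" using int[OF KD] by blast
        with integral[of s t] cd(2) have "integral K v = f t - f s" by (auto intro!: integral_unique)
        then show ?thesis using st by (simp add: dist_norm norm_minus_commute)
      qed
      ultimately show ?thesis by simp
    qed
    ultimately show ?thesis
      using bounded_variation_absolutely_integrable_interval[of v c d 1] by simp
  qed
  \<comment> \<open>\<open>n\<close> equal pieces have length \<open>h\<close> below
    \<open>\<delta>\<close>; the strict inequality forces \<open>n > 0\<close> even if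
    \<open>a = b\<close>.\<close>
  obtain n :: nat where n: "(b - a) / \<delta> < real n" using reals_Archimedean2 by blast
  define h where "h = (b - a) / real n"
  have npos: "n > 0" using n \<open>a \<le> b\<close> \<delta>(1) by (metis divide_nonneg_pos diff_ge_0_iff_ge gr0I not_less of_nat_0)
  have h: "0 \<le> h" "h < \<delta>" "a + real n * h = b"
    using n npos \<open>a \<le> b\<close> \<delta>(1) by (auto simp: h_def field_simps)
  have "v absolutely_integrable_on {a..a + real k * h}" if "k \<le> n" for k
    using that
  proof (induction k)
    case 0
    show ?case using short[of a a] \<open>a \<le> b\<close> \<delta>(1) by simp
  next
    case (Suc k)
    have kn: "a + real (Suc k) * h \<le> b" using Suc.prems h by (metis add_left_mono mult_right_mono of_nat_le_iff)
    have k0: "0 \<le> real k * h" using h(1) by simp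
    have "{a..a + real (Suc k) * h} = {a..a + real k * h} \<union> {a + real k * h..a + real (Suc k) * h}"
      using k0 h(1) by (subst ivl_disj_un_two_touch(4)) (auto simp: distrib_right)
    moreover have "v absolutely_integrable_on {a + real k * h..a + real (Suc k) * h}"
      by (rule short) (use h kn in \<open>auto simp: algebra_simps\<close>)
    ultimately show ?case
      using absolutely_integrable_Un[OF Suc.IH] Suc.prems by auto
  qed
  from this[of n] show ?thesis using h(3) by simp
qed


section \<open>Comparison of the Carnot-Caratheodory distance with coordinates\<close>

definition hproj :: "heis \<Rightarrow> complex" where
  "hproj p = Complex (fst p) (fst (snd p))"

text \<open>The determinant of two plane vectors. The complex form makes its bound by the product of
  the norms a consequence of the multiplicativity of the modulus.\<close>

definition wedge :: "complex \<Rightarrow> complex \<Rightarrow> real" where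
  "wedge v w = Im (cnj v * w)"

text \<open>The third coordinate of the group element leading from \<open>p\<close> to
  \<open>q\<close>, where \<open>- p\<close> is the group inverse of \<open>p\<close>; see
  \<open>snd_heis_mult_minus\<close>.\<close>

definition heis_height :: "heis \<Rightarrow> heis \<Rightarrow> real" where
  "heis_height p q = snd (snd q) - snd (snd p) - wedge (hproj p) (hproj q) / 2"

lemma abs_wedge_le: "\<bar>wedge v w\<bar> \<le> norm v * norm w"
  unfolding wedge_def using abs_Im_le_cmod[of "cnj v * w"] by (simp add: norm_mult)

lemma bounded_linear_hproj: "bounded_linear hproj"
  by (intro linear_conv_bounded_linear[THEN iffD1] linearI) (auto simp: hproj_def complex_eq_iff)

lemma hproj_diff: "hproj (p - q) = hproj p - hproj q"
  by (simp add: hproj_def complex_eq_iff)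

lemma norm_hproj: "norm (hproj (x, y, z)) = sqrt (x\<^sup>2 + y\<^sup>2)"
  by (simp add: hproj_def complex_norm)

lemma hproj_heis_mult_minus: "hproj (heis_mult (- p) q) = hproj q - hproj p"
  by (cases p; cases q) (simp add: hproj_def complex_eq_iff)

lemma snd_heis_mult_minus: "snd (snd (heis_mult (- p) q)) = heis_height p q"
  by (cases p; cases q) (simp add: hproj_def heis_height_def wedge_def field_simps)

lemma heis_mult_minus_self: "heis_mult (- p) p = 0"
  by (cases p) (simp add: zero_prod_def)

section \<open>Length of a horizontal curve against displacement and height\<close>

text \<open>The velocity is set to 0 on the exceptional null set. Integrals do not notice this,
  while the bound on the vertical velocity now holds at every point, so that the estimates below can
  compare integrands pointwise.\<close>

lemma horizontal_curve_velocity: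
  assumes hc: "horizontal_curve a b \<gamma>" and "a < b"
  obtains v where "v absolutely_integrable_on {a..b}"
    "\<And>t. t \<in> {a..b} \<Longrightarrow> (v has_integral (\<gamma> t - \<gamma> a)) {a..t}"
    "\<And>t. t \<in> {a..b} \<Longrightarrow> \<bar>snd (snd (v t))\<bar> \<le> norm (hproj (\<gamma> t)) * norm (hproj (v t)) / 2"
    "heis_length a b \<gamma> = integral {a..b} (\<lambda>t. norm (hproj (v t)))"
proof -
  have ac: "abs_continuous_on a b \<gamma>" using hc by (simp add: horizontal_curve_def)
  define Q where "Q t \<longleftrightarrow> (\<exists>x y z x' y' z'.
      \<gamma> t = (x, y, z) \<and> (\<gamma> has_vector_derivative (x', y', z')) (at t within {a..b}) \<and>
      z' = (x * y' - y * x') / 2)" for t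
  have "AE t in lebesgue_on {a..b}. Q t" using hc by (simp add: horizontal_curve_def Q_def)
  then have "AE t in lebesgue. t \<in> {a..b} \<longrightarrow> Q t" by (subst (asm) AE_restrict_space_iff) auto
  then obtain N where N: "N \<in> null_sets lebesgue" "{t. \<not> (t \<in> {a..b} \<longrightarrow> Q t)} \<subseteq> N"
    unfolding eventually_ae_filter by auto
  then have neg: "negligible N" by (simp add: negligible_iff_null_sets)
  define D where "D t = vector_derivative \<gamma> (at t within {a..b})" for t
  define v where "v t = (if t \<in> N then 0 else D t)" for t
  have DQ: "(\<gamma> has_vector_derivative D t) (at t within {a..b}) \<and>
      \<bar>snd (snd (D t))\<bar> \<le> norm (hproj (\<gamma> t)) * norm (hproj (D t)) / 2" if t: "t \<in> {a..b} - N" for t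
  proof -
    obtain x y z x' y' z' where q: "\<gamma> t = (x, y, z)"
      "(\<gamma> has_vector_derivative (x', y', z')) (at t within {a..b})" "z' = (x * y' - y * x') / 2"
      using N(2) t unfolding Q_def by blast
    have D: "D t = (x', y', z')"
      unfolding D_def using vector_derivative_within_cbox[of a b t \<gamma> "(x', y', z')"] q(2) t \<open>a < b\<close> by simp
    have "z' = wedge (hproj (\<gamma> t)) (hproj (D t)) / 2"
      by (simp add: q D wedge_def hproj_def)
    then show ?thesis
      using D q(2) abs_wedge_le[of "hproj (\<gamma> t)" "hproj (D t)"] by simp
  qed
  have vD: "(\<gamma> has_vector_derivative v t) (at t within {a..b})" if "t \<in> {a..b} - N" for t
    using DQ[OF that] that by (simp add: v_def)
  have ai: "v absolutely_integrable_on {a..b}"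
    by (rule abs_continuous_absolutely_integrable[OF _ ac neg vD]) (use \<open>a < b\<close> in auto)
  have hi: "(v has_integral (\<gamma> t - \<gamma> a)) {a..t}" if t: "t \<in> {a..b}" for t
  proof (rule abs_continuous_has_integral[OF _ abs_continuous_on_subinterval[OF ac] neg])
    fix s assume "s \<in> {a..t} - N"
    then show "(\<gamma> has_vector_derivative v s) (at s within {a..t})"
      using has_vector_derivative_within_subset[OF vD[of s]] t by auto
  qed (use t in auto)
  have aD: "D absolutely_integrable_on {a..b}"
    by (rule absolutely_integrable_spike[OF ai neg]) (auto simp: v_def)
  have "(norm \<circ> (hproj \<circ> D)) absolutely_integrable_on {a..b}"
    by (intro absolutely_integrable_norm absolutely_integrable_linear[OF aD bounded_linear_hproj])
  then have "integrable (lebesgue_on {a..b}) (norm \<circ> (hproj \<circ> D))"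
    by (rule absolutely_integrable_imp_integrable) auto
  then have "(LINT t|lebesgue_on {a..b}. (norm \<circ> (hproj \<circ> D)) t) = integral {a..b} (norm \<circ> (hproj \<circ> D))"
    by (rule lebesgue_integral_eq_integral) auto
  moreover have "(case d of (x', y', z') \<Rightarrow> sqrt (x'\<^sup>2 + y'\<^sup>2)) = norm (hproj d)" for d
    by (cases d) (simp add: norm_hproj)
  ultimately have "heis_length a b \<gamma> = integral {a..b} (norm \<circ> (hproj \<circ> D))"
    by (simp add: heis_length_def D_def o_def)
  also have "\<dots> = integral {a..b} (\<lambda>t. norm (hproj (v t)))"
    by (rule integral_spike[OF neg]) (simp add: v_def)
  finally have "heis_length a b \<gamma> = integral {a..b} (\<lambda>t. norm (hproj (v t)))" .
  moreover have "\<bar>snd (snd (v t))\<bar> \<le> norm (hproj (\<gamma> t)) * norm (hproj (v t)) / 2" if "t \<in> {a..b}" for t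
    using DQ[of t] that by (auto simp: v_def)
  ultimately show ?thesis using that ai hi by blast
qed

lemma heis_length_nonneg: "0 \<le> heis_length a b \<gamma>"
  unfolding heis_length_def by (rule Bochner_Integration.integral_nonneg) (simp split: prod.split)

lemma hproj_le_heis_length:
  assumes hc: "horizontal_curve a b \<gamma>" and t: "t \<in> {a..b}"
  shows "norm (hproj (\<gamma> t) - hproj (\<gamma> a)) \<le> heis_length a b \<gamma>"
proof (cases "a < b")
  case True
  obtain v where v: "v absolutely_integrable_on {a..b}"
    "\<And>t. t \<in> {a..b} \<Longrightarrow> (v has_integral (\<gamma> t - \<gamma> a)) {a..t}"
    "heis_length a b \<gamma> = integral {a..b} (\<lambda>t. norm (hproj (v t)))"
    using horizontal_curve_velocity[OF hc True] by metis
  have hv: "(hproj \<circ> v) absolutely_integrable_on {a..b}"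
    by (rule absolutely_integrable_linear[OF v(1) bounded_linear_hproj])
  then have I: "(\<lambda>t. norm (hproj (v t))) integrable_on {a..b}"
    by (simp add: absolutely_integrable_on_def o_def)
  have It: "(\<lambda>t. norm (hproj (v t))) integrable_on {a..t}"
    by (rule integrable_subinterval_real[OF I]) (use t in auto)
  have "((hproj \<circ> v) has_integral hproj (\<gamma> t - \<gamma> a)) {a..t}"
    by (rule has_integral_linear[OF v(2)[OF t] bounded_linear_hproj])
  then have "norm (hproj (\<gamma> t - \<gamma> a)) \<le> integral {a..t} (\<lambda>t. norm (hproj (v t)))"
    using integral_norm_bound_integral[OF _ It, of "hproj \<circ> v"] by (auto simp: has_integral_iff)
  also have "\<dots> \<le> integral {a..b} (\<lambda>t. norm (hproj (v t)))"
    by (rule integral_subset_le[OF _ It I]) (use t in auto)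
  finally show ?thesis by (simp add: v(3) hproj_diff)
next
  case False
  then have "t = a" using t by simp
  then show ?thesis by (simp add: heis_length_nonneg)
qed

text \<open>The projection never leaves the disc around 0 whose radius is the length, so the
  vertical speed is at most half the length times the horizontal speed. Integrate.\<close>

lemma height_le_heis_length:
  assumes hc: "horizontal_curve a b \<gamma>" and 0: "\<gamma> a = 0"
  shows "\<bar>snd (snd (\<gamma> b))\<bar> \<le> (heis_length a b \<gamma>)\<^sup>2 / 2"
proof (cases "a < b")
  case True
  obtain v where v: "v absolutely_integrable_on {a..b}"
    "\<And>t. t \<in> {a..b} \<Longrightarrow> (v has_integral (\<gamma> t - \<gamma> a)) {a..t}"
    "\<And>t. t \<in> {a..b} \<Longrightarrow> \<bar>snd (snd (v t))\<bar> \<le> norm (hproj (\<gamma> t)) * norm (hproj (v t)) / 2"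
    "heis_length a b \<gamma> = integral {a..b} (\<lambda>t. norm (hproj (v t)))"
    using horizontal_curve_velocity[OF hc True] by metis
  let ?L = "heis_length a b \<gamma>"
  have "(hproj \<circ> v) absolutely_integrable_on {a..b}"
    by (rule absolutely_integrable_linear[OF v(1) bounded_linear_hproj])
  then have "(\<lambda>t. norm (hproj (v t))) integrable_on {a..b}"
    by (simp add: absolutely_integrable_on_def o_def)
  then have "((\<lambda>t. norm (hproj (v t))) has_integral ?L) {a..b}"
    by (simp add: v(4) has_integral_iff)
  then have I: "((\<lambda>t. ?L / 2 * norm (hproj (v t))) has_integral (?L / 2 * ?L)) {a..b}"
    by (rule has_integral_mult_right)
  have h0: "hproj 0 = 0" by (simp add: hproj_def complex_eq_iff)
  have bl: "bounded_linear (\<lambda>p :: heis. snd (snd p))"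
    by (intro bounded_linear_intros bounded_linear_compose[OF bounded_linear_snd])
  have z: "(((\<lambda>p. snd (snd p)) \<circ> v) has_integral snd (snd (\<gamma> b))) {a..b}"
    using has_integral_linear[OF v(2)[of b] bl] True 0 by simp
  have "\<bar>snd (snd (v t))\<bar> \<le> ?L / 2 * norm (hproj (v t))" if t: "t \<in> {a..b}" for t
  proof -
    have "norm (hproj (\<gamma> t)) \<le> ?L" using hproj_le_heis_length[OF hc t] 0 h0 by simp
    then have "norm (hproj (\<gamma> t)) * norm (hproj (v t)) / 2 \<le> ?L * norm (hproj (v t)) / 2"
      by (simp add: mult_right_mono)
    with v(3)[OF t] show ?thesis by simp
  qed
  then have "norm (snd (snd (\<gamma> b))) \<le> ?L / 2 * ?L"
    using integral_norm_bound_integral[of "(\<lambda>p. snd (snd p)) \<circ> v" "{a..b}" "\<lambda>t. ?L / 2 * norm (hproj (v t))"] z I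
    by (auto simp: has_integral_iff)
  then show ?thesis by (simp add: power2_eq_square)
next
  case False
  then have "b = a" using hc by (simp add: horizontal_curve_def)
  then show ?thesis by (simp add: 0)
qed

section \<open>Explicit horizontal curves from the origin to a given point\<close>

lemma lipschitz_imp_abs_continuous_on:
  assumes "\<And>s t. s \<in> {a..b} \<Longrightarrow> t \<in> {a..b} \<Longrightarrow> dist (f s) (f t) \<le> B * \<bar>s - t\<bar>"
  shows "abs_continuous_on a b f"
  unfolding abs_continuous_on_def
proof (intro allI impI)
  fix \<epsilon> :: real assume "\<epsilon> > 0"
  show "\<exists>\<delta>>0. \<forall>D. D division_of \<Union>D \<longrightarrow> \<Union>D \<subseteq> {a..b} \<longrightarrow> (\<Sum>K\<in>D. Sup K - Inf K) < \<delta> \<longrightarrow>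
      (\<Sum>K\<in>D. dist (f (Inf K)) (f (Sup K))) < \<epsilon>"
  \<comment> \<open>\<open>B\<close> may be zero or negative, so it is replaced by a positive
    Lipschitz constant.\<close>
  proof (intro exI[of _ "\<epsilon> / (\<bar>B\<bar> + 1)"] conjI allI impI)
    fix D assume D: "D division_of \<Union>D" "\<Union>D \<subseteq> {a..b}" "(\<Sum>K\<in>D. Sup K - Inf K) < \<epsilon> / (\<bar>B\<bar> + 1)"
    have "dist (f (Inf K)) (f (Sup K)) \<le> (\<bar>B\<bar> + 1) * (Sup K - Inf K)" if KD: "K \<in> D" for K
    proof -
      obtain s t where "K = cbox s t" "K \<noteq> {}" using division_ofD(3,4)[OF D(1) KD] by blast
      then have st: "K = {s..t}" "s \<le> t" by auto
      then have "s \<in> {a..b}" "t \<in> {a..b}" using KD D(2) by fastforce+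
      then have "dist (f s) (f t) \<le> B * \<bar>s - t\<bar>" by (rule assms)
      also have "\<dots> \<le> (\<bar>B\<bar> + 1) * (t - s)" using st by (simp add: mult_right_mono)
      finally show ?thesis using st by simp
    qed
    then have "(\<Sum>K\<in>D. dist (f (Inf K)) (f (Sup K))) \<le> (\<bar>B\<bar> + 1) * (\<Sum>K\<in>D. Sup K - Inf K)"
      unfolding sum_distrib_left by (rule sum_mono)
    also have "\<dots> < \<epsilon>" using D(3) by (simp add: field_simps)
    finally show "(\<Sum>K\<in>D. dist (f (Inf K)) (f (Sup K))) < \<epsilon>" .
  qed (use \<open>\<epsilon> > 0\<close> in simp)
qed

text \<open>For a continuously differentiable curve the conditions required almost everywhere can be
  checked at every point. Absolute continuity comes from the bounded derivative, and the length is
  at most the maximal speed because the parameter interval has length 1.\<close>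

lemma smooth_horizontal_curve:
  fixes \<gamma> \<gamma>' :: "real \<Rightarrow> heis"
  assumes D: "\<And>t. (\<gamma> has_vector_derivative \<gamma>' t) (at t)" and c: "continuous_on {0..1} \<gamma>'"
    and h: "\<And>t. snd (snd (\<gamma>' t)) = wedge (hproj (\<gamma> t)) (hproj (\<gamma>' t)) / 2"
    and B: "\<And>t. t \<in> {0..1} \<Longrightarrow> norm (hproj (\<gamma>' t)) \<le> B"
  shows "horizontal_curve 0 1 \<gamma>" "heis_length 0 1 \<gamma> \<le> B"
proof -
  have Dw: "(\<gamma> has_vector_derivative \<gamma>' t) (at t within {0..1})" for t
    by (rule has_vector_derivative_at_within[OF D])
  have "bounded (\<gamma>' ` {0..1})" by (intro compact_imp_bounded compact_continuous_image c) auto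
  then obtain M where M: "\<And>t. t \<in> {0..1} \<Longrightarrow> norm (\<gamma>' t) \<le> M"
    unfolding bounded_iff by blast
  have lip: "dist (\<gamma> s) (\<gamma> t) \<le> M * \<bar>s - t\<bar>" if "s \<in> {0..1}" "t \<in> {0..1}" for s t
  proof -
    have "norm (\<gamma> s - \<gamma> t) \<le> M * norm (s - t)"
    proof (rule differentiable_bound[where S = "{0..1}" and f' = "\<lambda>t x. x *\<^sub>R \<gamma>' t"])
      show "(\<gamma> has_derivative (\<lambda>x. x *\<^sub>R \<gamma>' t)) (at t within {0..1})" for t
        using Dw[of t] by (simp add: has_vector_derivative_def)
      show "onorm (\<lambda>x. x *\<^sub>R \<gamma>' t) \<le> M" if "t \<in> {0..1}" for t
        by (rule onorm_le) (use M[OF that] in \<open>simp add: mult_left_mono mult.commute[of M]\<close>)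
    qed (use that in auto)
    then show ?thesis by (simp add: dist_norm)
  qed
  show "horizontal_curve 0 1 \<gamma>"
    unfolding horizontal_curve_def
  proof (intro conjI AE_I2)
    show "abs_continuous_on 0 1 \<gamma>" by (rule lipschitz_imp_abs_continuous_on[OF lip])
    fix t :: real
    obtain x y z x' y' z' where "\<gamma> t = (x, y, z)" "\<gamma>' t = (x', y', z')" by (metis prod_cases3)
    then show "\<exists>x y z x' y' z'. \<gamma> t = (x, y, z) \<and>
        (\<gamma> has_vector_derivative (x', y', z')) (at t within {0..1}) \<and> z' = (x * y' - y * x') / 2"
      using Dw[of t] h[of t] by (fastforce simp: wedge_def hproj_def)
  qed simp
  have B0: "0 \<le> B" using B[of 0] norm_ge_zero[of "hproj (\<gamma>' 0)"] by (simp del: norm_ge_zero)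
  have "heis_length 0 1 \<gamma> \<le> (LINT t|lebesgue_on {0..1::real}. B)"
    unfolding heis_length_def
  proof (rule integral_mono')
    fix t :: real assume "t \<in> space (lebesgue_on {0..1})"
    then have t: "t \<in> {0..1}" by simp
    then have "vector_derivative \<gamma> (at t within {0..1}) = \<gamma>' t"
      using vector_derivative_within_cbox[of 0 1 t \<gamma>] Dw by simp
    then show "(case vector_derivative \<gamma> (at t within {0..1}) of (x', y', z') \<Rightarrow> sqrt (x'\<^sup>2 + y'\<^sup>2)) \<le> B"
      using B[OF t] by (cases "\<gamma>' t") (simp add: norm_hproj)
  qed (auto simp: B0)
  also have "\<dots> = B" by (simp add: measure_restrict_space)
  finally show "heis_length 0 1 \<gamma> \<le> B" .
qed

text \<open>The loop components \<open>f\<close> and \<open>g\<close> have mean zero, so that they enclose no area together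
  with the chord; together they enclose the signed area \<open>-\<sigma> * \<tau> / 70\<close>.\<close>

lemma horizontal_curve_exists:
  obtains \<gamma> where "horizontal_curve 0 1 \<gamma>" "\<gamma> 0 = 0" "\<gamma> 1 = (x, y, z)"
    "heis_length 0 1 \<gamma> \<le> \<bar>x\<bar> + \<bar>y\<bar> + 76 * sqrt (70 * \<bar>z\<bar>)"
proof -
  \<comment> \<open>The final height will be \<open>- \<sigma> * \<tau> / 70\<close>, so the product
    of the two amplitudes has to be \<open>- 70 * z\<close>.\<close>
  define \<sigma> where "\<sigma> = sqrt (70 * \<bar>z\<bar>)"
  define \<tau> where "\<tau> = - sgn z * \<sigma>"
  define f :: "real \<Rightarrow> real" where "f t = t - 3 * t^2 + 2 * t^3" for t
  define f' :: "real \<Rightarrow> real" where "f' t = 1 - 6 * t + 6 * t^2" for t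
  define g :: "real \<Rightarrow> real" where "g t = t - 6 * t^2 + 10 * t^3 - 5 * t^4" for t
  define g' :: "real \<Rightarrow> real" where "g' t = 1 - 12 * t + 30 * t^2 - 20 * t^3" for t
  \<comment> \<open>\<open>w1\<close>, \<open>w2\<close> and \<open>w3\<close> are the primitives
    vanishing at 0 of \<open>t * g' t - g t\<close>, \<open>f t - t * f' t\<close> and
    \<open>f t * g' t - g t * f' t\<close>. These are the parts of the area form that survive after
    the \<open>x * y\<close> terms cancel. At 1 the first two vanish and the third is
    \<open>- 1/35\<close>.\<close>
  define w1 :: "real \<Rightarrow> real" where "w1 t = 5 * t^4 - 2 * t^3 - 3 * t^5" for t
  define w2 :: "real \<Rightarrow> real" where "w2 t = t^3 - t^4" for t
  define w3 :: "real \<Rightarrow> real" where "w3 t = 4 * t^4 - t^3 - 33/5 * t^5 + 5 * t^6 - 10/7 * t^7" for t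
  define w where "w t = (x * \<tau> * w1 t + y * \<sigma> * w2 t + \<sigma> * \<tau> * w3 t) / 2" for t
  define w' where "w' t = ((x * t + \<sigma> * f t) * (y + \<tau> * g' t) - (y * t + \<tau> * g t) * (x + \<sigma> * f' t)) / 2" for t
  define \<gamma> where "\<gamma> t = (x * t + \<sigma> * f t, y * t + \<tau> * g t, w t)" for t
  define \<gamma>' where "\<gamma>' t = (x + \<sigma> * f' t, y + \<tau> * g' t, w' t)" for t
  have df: "(f has_real_derivative f' t) (at t)" for t
    unfolding f_def f'_def by (auto intro!: derivative_eq_intros)
  have dg: "(g has_real_derivative g' t) (at t)" for t
    unfolding g_def g'_def by (auto intro!: derivative_eq_intros)
  have dw1: "(w1 has_real_derivative 20 * t^3 - 6 * t^2 - 15 * t^4) (at t)" for t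
    unfolding w1_def by (auto intro!: derivative_eq_intros)
  have dw2: "(w2 has_real_derivative 3 * t^2 - 4 * t^3) (at t)" for t
    unfolding w2_def by (auto intro!: derivative_eq_intros)
  have dw3: "(w3 has_real_derivative 16 * t^3 - 3 * t^2 - 33 * t^4 + 30 * t^5 - 10 * t^6) (at t)" for t
    unfolding w3_def by (auto intro!: derivative_eq_intros)
  have w': "w' t = (x * \<tau> * (20 * t^3 - 6 * t^2 - 15 * t^4) + y * \<sigma> * (3 * t^2 - 4 * t^3) +
      \<sigma> * \<tau> * (16 * t^3 - 3 * t^2 - 33 * t^4 + 30 * t^5 - 10 * t^6)) / 2" for t
  proof -
    have "(x * t + \<sigma> * f t) * (y + \<tau> * g' t) - (y * t + \<tau> * g t) * (x + \<sigma> * f' t) =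
      x * \<tau> * (20 * t^3 - 6 * t^2 - 15 * t^4) + y * \<sigma> * (3 * t^2 - 4 * t^3) +
      \<sigma> * \<tau> * (16 * t^3 - 3 * t^2 - 33 * t^4 + 30 * t^5 - 10 * t^6)"
      unfolding f_def g_def f'_def g'_def by algebra
    then show ?thesis by (simp add: w'_def)
  qed
  have dw: "(w has_real_derivative w' t) (at t)" for t
    unfolding w_def w' by (auto intro!: derivative_eq_intros dw1 dw2 dw3)
  have dx: "((\<lambda>t. x * t + \<sigma> * f t) has_real_derivative x + \<sigma> * f' t) (at t)" for t
    by (auto intro!: derivative_eq_intros df)
  have dy: "((\<lambda>t. y * t + \<tau> * g t) has_real_derivative y + \<tau> * g' t) (at t)" for t
    by (auto intro!: derivative_eq_intros dg)
  note d = dx dy dw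
  have "(\<gamma> has_vector_derivative \<gamma>' t) (at t)" for t
    unfolding \<gamma>_def \<gamma>'_def
    by (intro has_vector_derivative_Pair d[unfolded has_real_derivative_iff_has_vector_derivative])
  moreover have "continuous_on {0..1} \<gamma>'"
    unfolding \<gamma>'_def w'_def f_def g_def f'_def g'_def by (auto intro!: continuous_intros)
  moreover have "snd (snd (\<gamma>' t)) = wedge (hproj (\<gamma> t)) (hproj (\<gamma>' t)) / 2" for t
    by (simp only: \<gamma>_def \<gamma>'_def w'_def wedge_def hproj_def fst_conv snd_conv complex_cnj times_complex.simps complex.sel) argo
  moreover have "norm (hproj (\<gamma>' t)) \<le> \<bar>x\<bar> + \<bar>y\<bar> + 76 * \<sigma>" if t: "t \<in> {0..1}" for t
  proof -
    have p: "0 \<le> t^n" "t^n \<le> 1" for n using t by (auto intro: power_le_one)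
    \<comment> \<open>On \<open>[0, 1]\<close> the sums of the absolute coefficients bound the
      derivatives: 13 = 1 + 6 + 6 and 63 = 1 + 12 + 30 + 20. Their sum is the constant 76.\<close>
    have "\<bar>f' t\<bar> \<le> 13" unfolding f'_def using t p[of 2] unfolding abs_le_iff atLeastAtMost_iff by linarith
    moreover have "\<bar>g' t\<bar> \<le> 63" unfolding g'_def using t p[of 2] p[of 3] unfolding abs_le_iff atLeastAtMost_iff by linarith
    moreover have "0 \<le> \<sigma>" "\<bar>\<tau>\<bar> \<le> \<sigma>" by (auto simp: \<sigma>_def \<tau>_def abs_mult sgn_if)
    ultimately have "\<bar>\<sigma> * f' t\<bar> \<le> \<sigma> * 13" "\<bar>\<tau> * g' t\<bar> \<le> \<sigma> * 63"
      unfolding abs_mult by (auto intro!: mult_mono)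
    moreover have "norm (hproj (\<gamma>' t)) \<le> \<bar>x + \<sigma> * f' t\<bar> + \<bar>y + \<tau> * g' t\<bar>"
      using cmod_le[of "hproj (\<gamma>' t)"] by (simp add: \<gamma>'_def hproj_def)
    ultimately show ?thesis by linarith
  qed
  ultimately have "horizontal_curve 0 1 \<gamma>" "heis_length 0 1 \<gamma> \<le> \<bar>x\<bar> + \<bar>y\<bar> + 76 * \<sigma>"
    using smooth_horizontal_curve[of \<gamma> \<gamma>'] by blast+
  moreover have "\<gamma> 0 = 0" by (simp add: \<gamma>_def f_def g_def w_def w1_def w2_def w3_def zero_prod_def)
  moreover have "\<gamma> 1 = (x, y, z)"
  proof -
    have "\<sigma> * \<tau> = - sgn z * (\<sigma> * \<sigma>)" by (simp add: \<tau>_def)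
    also have "\<dots> = - 70 * z" by (simp add: \<sigma>_def mult_sgn_abs)
    finally show ?thesis by (simp add: \<gamma>_def f_def g_def w_def w1_def w2_def w3_def)
  qed
  ultimately show ?thesis using that[of \<gamma>] by (simp add: \<sigma>_def)
qed

section \<open>Bounds for the distance by displacement and height\<close>

lemma heis_dist_eq_from_zero: "heis_dist p q = heis_dist 0 (heis_mult (- p) q)"
  using heis_dist_left_invariant[of "- p" p q] by (simp add: heis_mult_minus_self)

text \<open>After a left translation the explicit curve competes in the infimum. The factor 2 bounds
  the sum of the absolute coordinates by the norm.\<close>

lemma heis_dist_le:
  "heis_dist p q \<le> 2 * norm (hproj q - hproj p) + 76 * sqrt (70 * \<bar>heis_height p q\<bar>)"
proof -
  obtain x y z where xyz: "heis_mult (- p) q = (x, y, z)" by (cases "heis_mult (- p) q")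
  have v: "hproj q - hproj p = Complex x y" "heis_height p q = z"
    using hproj_heis_mult_minus[of p q] snd_heis_mult_minus[of p q] by (auto simp: xyz hproj_def)
  obtain \<gamma> where \<gamma>: "horizontal_curve 0 1 \<gamma>" "\<gamma> 0 = 0" "\<gamma> 1 = (x, y, z)"
    "heis_length 0 1 \<gamma> \<le> \<bar>x\<bar> + \<bar>y\<bar> + 76 * sqrt (70 * \<bar>z\<bar>)"
    by (rule horizontal_curve_exists)
  have "heis_dist p q \<le> heis_length 0 1 \<gamma>"
    unfolding trans[OF heis_dist_eq_from_zero heis_dist_def, of p q]
    by (rule cInf_lower) (use \<gamma> xyz heis_length_nonneg in \<open>auto intro!: bdd_belowI[of _ 0]\<close>)
  also have "\<dots> \<le> 2 * norm (Complex x y) + 76 * sqrt (70 * \<bar>z\<bar>)"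
    using \<gamma>(4) abs_Re_le_cmod[of "Complex x y"] abs_Im_le_cmod[of "Complex x y"] by simp
  finally show ?thesis by (simp add: v)
qed

text \<open>Lower bounds on lengths pass to the infimum only if some horizontal curve joins the
  points, which \<open>horizontal_curve_exists\<close> guarantees.\<close>

lemma heis_dist_geI:
  assumes "\<And>a b \<gamma>. horizontal_curve a b \<gamma> \<Longrightarrow> \<gamma> a = 0 \<Longrightarrow> \<gamma> b = heis_mult (- p) q \<Longrightarrow> r \<le> heis_length a b \<gamma>"
  shows "r \<le> heis_dist p q"
  unfolding trans[OF heis_dist_eq_from_zero heis_dist_def, of p q]
proof (rule cInf_greatest)
  obtain x y z where xyz: "heis_mult (- p) q = (x, y, z)" by (cases "heis_mult (- p) q")
  then show "{heis_length a b \<gamma> | a b \<gamma>. horizontal_curve a b \<gamma> \<and> \<gamma> a = 0 \<and> \<gamma> b = heis_mult (- p) q} \<noteq> {}"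
    by simp (metis horizontal_curve_exists)
qed (use assms in auto)

lemma hproj_le_heis_dist: "norm (hproj q - hproj p) \<le> heis_dist p q"
proof (rule heis_dist_geI)
  fix a b \<gamma> assume \<gamma>: "horizontal_curve a b \<gamma>" "\<gamma> a = 0" "\<gamma> b = heis_mult (- p) q"
  have h0: "hproj 0 = 0" by (simp add: hproj_def complex_eq_iff)
  have "b \<in> {a..b}" using \<gamma>(1) by (simp add: horizontal_curve_def)
  from hproj_le_heis_length[OF \<gamma>(1) this] show "norm (hproj q - hproj p) \<le> heis_length a b \<gamma>"
    by (simp add: \<gamma> h0 hproj_heis_mult_minus)
qed

lemma heis_dist_nonneg: "0 \<le> heis_dist p q"
  using hproj_le_heis_dist norm_ge_zero order_trans by blast

lemma heis_height_le_heis_dist: "\<bar>heis_height p q\<bar> \<le> (heis_dist p q)\<^sup>2 / 2"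
proof -
  \<comment> \<open>The square root turns the quadratic estimate into a lower bound on lengths, as
    \<open>heis_dist_geI\<close> requires.\<close>
  have "sqrt (2 * \<bar>heis_height p q\<bar>) \<le> heis_dist p q"
  proof (rule heis_dist_geI)
    fix a b \<gamma> assume \<gamma>: "horizontal_curve a b \<gamma>" "\<gamma> a = 0" "\<gamma> b = heis_mult (- p) q"
    have "2 * \<bar>heis_height p q\<bar> \<le> (heis_length a b \<gamma>)\<^sup>2"
      using height_le_heis_length[OF \<gamma>(1,2)] by (simp add: \<gamma> snd_heis_mult_minus)
    then show "sqrt (2 * \<bar>heis_height p q\<bar>) \<le> heis_length a b \<gamma>"
      by (rule real_le_lsqrt[rotated -1]) (auto simp: heis_length_nonneg)
  qed
  then have "2 * \<bar>heis_height p q\<bar> \<le> (heis_dist p q)\<^sup>2"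
    by (rule sqrt_le_D)
  then show ?thesis by simp
qed


section \<open>Quadratic energy of a curve along partitions\<close>

text \<open>On an increasing list this is the Dirichlet energy of the piecewise linear interpolation
  of \<open>f\<close>.\<close>

fun energy :: "(real \<Rightarrow> 'a::real_inner) \<Rightarrow> real list \<Rightarrow> real" where
  "energy f (s # t # ts) = (norm (f t - f s))\<^sup>2 / (t - s) + energy f (t # ts)"
| "energy f _ = 0"

definition chord_deviation :: "(real \<Rightarrow> 'a::real_inner) \<Rightarrow> real \<Rightarrow> real \<Rightarrow> real \<Rightarrow> 'a" where
  "chord_deviation f a b t = f t - f a - ((t - a) / (b - a)) *\<^sub>R (f b - f a)"

text \<open>The mixed terms \<open>2 * (w \<bullet> e)\<close> cancel. What remains is the
  comparison \<open>1 / p + 1 / q \<ge> 4 / (p + q)\<close>, the source of the constant 4.\<close>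

lemma sum_norm_squares_ge:
  fixes w e :: "'a::real_inner"
  assumes "p > 0" "q > 0"
  shows "(p + q) * (norm w)\<^sup>2 + 4 * (norm e)\<^sup>2 / (p + q) \<le>
    (norm (p *\<^sub>R w + e))\<^sup>2 / p + (norm (q *\<^sub>R w - e))\<^sup>2 / q"
proof -
  have "(norm (p *\<^sub>R w + e))\<^sup>2 = p * (p * (norm w)\<^sup>2 + 2 * (w \<bullet> e)) + (norm e)\<^sup>2"
    by (simp add: power2_norm_eq_inner inner_simps inner_commute algebra_simps)
  then have "(norm (p *\<^sub>R w + e))\<^sup>2 / p = p * (norm w)\<^sup>2 + 2 * (w \<bullet> e) + (norm e)\<^sup>2 / p"
    using assms by (simp add: add_divide_distrib)
  moreover have "(norm (q *\<^sub>R w - e))\<^sup>2 = q * (q * (norm w)\<^sup>2 - 2 * (w \<bullet> e)) + (norm e)\<^sup>2"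
    by (simp add: power2_norm_eq_inner inner_simps inner_commute algebra_simps)
  then have "(norm (q *\<^sub>R w - e))\<^sup>2 / q = q * (norm w)\<^sup>2 - 2 * (w \<bullet> e) + (norm e)\<^sup>2 / q"
    using assms by (simp add: add_divide_distrib)
  moreover have "4 / (p + q) \<le> 1 / p + 1 / q"
  proof -
    have "0 \<le> (p - q)\<^sup>2" by simp
    then have "4 * (p * q) \<le> (p + q) * (p + q)" by (simp add: power2_eq_square algebra_simps)
    then show ?thesis using assms by (simp add: field_simps)
  qed
  then have "(norm e)\<^sup>2 * (4 / (p + q)) \<le> (norm e)\<^sup>2 * (1 / p + 1 / q)"
    by (rule mult_left_mono) simp
  then have "4 * (norm e)\<^sup>2 / (p + q) \<le> (norm e)\<^sup>2 / p + (norm e)\<^sup>2 / q"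
    by (simp add: algebra_simps)
  ultimately show ?thesis by (simp add: algebra_simps)
qed

text \<open>If \<open>w\<close> is the slope of the chord and \<open>e\<close> the deviation at
  \<open>t\<close>, then the two increments are \<open>(t - s) w + e\<close> and
  \<open>(r - t) w - e\<close>.\<close>

lemma energy_split:
  assumes "s < t" "t < r"
  shows "(norm (f r - f s))\<^sup>2 / (r - s) + 4 * (norm (chord_deviation f s r t))\<^sup>2 / (r - s) \<le>
    (norm (f t - f s))\<^sup>2 / (t - s) + (norm (f r - f t))\<^sup>2 / (r - t)"
proof -
  define w where "w = (1 / (r - s)) *\<^sub>R (f r - f s)"
  define e where "e = chord_deviation f s r t"
  have rs: "r - s > 0" using assms by simp
  have w: "(r - s) *\<^sub>R w = f r - f s" using rs by (simp add: w_def)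
  have 1: "(t - s) *\<^sub>R w + e = f t - f s" by (simp add: w_def e_def chord_deviation_def)
  have "(r - t) *\<^sub>R w - e = (r - s) *\<^sub>R w - ((t - s) *\<^sub>R w + e)" by (simp add: algebra_simps)
  then have 2: "(r - t) *\<^sub>R w - e = f r - f t" unfolding 1 w by simp
  have "(norm (f r - f s))\<^sup>2 / (r - s) = (r - s) * (norm w)\<^sup>2"
    using rs by (simp flip: w add: power_mult_distrib power2_eq_square)
  then show ?thesis
    using sum_norm_squares_ge[of "t - s" "r - t" w e] assms 1 2 by (simp add: e_def)
qed

lemma energy_nonneg: "sorted_wrt (<) xs \<Longrightarrow> 0 \<le> energy f xs"
  by (induction f xs rule: energy.induct) auto

text \<open>Induction on the finer list. If its next point \<open>y\<close> is missing from the
  coarser list, then \<open>y\<close> precedes the next point \<open>x\<close> there, and by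
  \<open>energy_split\<close> inserting it does not lower the energy.\<close>

lemma energy_mono_Cons:
  assumes "sorted_wrt (<) (a # xs)" "sorted_wrt (<) (a # ys)" "set xs \<subseteq> set ys"
  shows "energy f (a # xs) \<le> energy f (a # ys)"
  using assms
proof (induction ys arbitrary: a xs)
  case Nil
  then show ?case by simp
next
  case (Cons y ys)
  show ?case
  proof (cases xs)
    case Nil
    then show ?thesis using energy_nonneg[OF Cons.prems(2)] by simp
  next
    case (Cons x xs')
    show ?thesis
    proof (cases "x = y")
      case True
      have "y \<notin> set xs'" using Cons.prems(1) \<open>xs = x # xs'\<close> True by auto
      then have "energy f (y # xs') \<le> energy f (y # ys)"
        using Cons.prems \<open>xs = x # xs'\<close> True by (intro Cons.IH) auto
      then show ?thesis using True \<open>xs = x # xs'\<close> by simp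
    next
      case False
      then have xy: "a < y" "y < x" using Cons.prems \<open>xs = x # xs'\<close> by auto
      have "y \<notin> set xs" using xy Cons.prems(1) \<open>xs = x # xs'\<close> by auto
      then have "energy f (y # xs) \<le> energy f (y # ys)"
        using Cons.prems \<open>xs = x # xs'\<close> xy by (intro Cons.IH) auto
      moreover have "(norm (f x - f a))\<^sup>2 / (x - a) \<le> (norm (f y - f a))\<^sup>2 / (y - a) + (norm (f x - f y))\<^sup>2 / (x - y)"
        using energy_split[OF xy, of f] xy zero_le_power2[of "norm (chord_deviation f a x y)"]
          divide_nonneg_nonneg[of "4 * (norm (chord_deviation f a x y))\<^sup>2" "x - a"] by linarith
      ultimately show ?thesis using \<open>xs = x # xs'\<close> by simp
    qed
  qed
qed

lemma energy_mono:
  assumes "sorted_wrt (<) xs" "sorted_wrt (<) ys" "set xs \<subseteq> set ys"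
  shows "energy f xs \<le> energy f ys"
proof (cases xs)
  case Nil
  then show ?thesis using energy_nonneg[OF assms(2)] by simp
next
  case xs: (Cons x xs')
  then obtain y ys' where ys: "ys = y # ys'" using assms(3) by (cases ys) auto
  show ?thesis
  proof (cases "x = y")
    case True
    have "y \<notin> set xs'" using assms(1) xs True by auto
    then show ?thesis
      using assms energy_mono_Cons[of y xs' ys' f] by (auto simp: xs ys True)
  next
    case False
    then have "y < x" using assms xs ys by auto
    then have "y \<notin> set xs" using assms(1) xs by auto
    have "energy f xs \<le> energy f (y # xs)" using \<open>y < x\<close> by (simp add: xs)
    also have "\<dots> \<le> energy f ys"
      using assms \<open>y < x\<close> \<open>y \<notin> set xs\<close> unfolding ys xs by (intro energy_mono_Cons) auto
    finally show ?thesis .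
  qed
qed

text \<open>An interval of length \<open>l\<close> contributes at most \<open>C^2 * l\<close>, and
  the lengths telescope. This makes the supremum of the energies finite.\<close>

lemma energy_le_lipschitz:
  assumes "\<And>s t. s \<in> A \<Longrightarrow> t \<in> A \<Longrightarrow> norm (f t - f s) \<le> C * \<bar>t - s\<bar>" "0 \<le> C"
    and "sorted_wrt (<) (x # xs)" "set (x # xs) \<subseteq> A"
  shows "energy f (x # xs) \<le> C\<^sup>2 * (last (x # xs) - x)"
  using assms(3,4)
proof (induction xs arbitrary: x)
  case Nil
  then show ?case by simp
next
  case (Cons y ys)
  have xy: "x < y" using Cons.prems by simp
  have "norm (f y - f x) \<le> C * (y - x)" using assms(1)[of x y] Cons.prems by simp
  then have "(norm (f y - f x))\<^sup>2 \<le> (C * (y - x))\<^sup>2" by (rule power_mono) simp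
  then have "(norm (f y - f x))\<^sup>2 / (y - x) \<le> C\<^sup>2 * (y - x)"
    using xy by (simp add: divide_simps power_mult_distrib power2_eq_square[of "y - x"] ac_simps)
  moreover have "energy f (y # ys) \<le> C\<^sup>2 * (last (y # ys) - y)"
    using Cons.prems by (intro Cons.IH) auto
  ultimately show ?case by (simp add: algebra_simps)
qed

lemma energy_snoc:
  "energy f (xs @ [s, t]) = energy f (xs @ [s]) + (norm (f t - f s))\<^sup>2 / (t - s)"
proof (induction xs)
  case (Cons x xs)
  then show ?case by (cases xs) auto
qed simp

lemma energy_map_upt:
  "energy f (map q [0..<Suc n]) = (\<Sum>i<n. (norm (f (q (Suc i)) - f (q i)))\<^sup>2 / (q (Suc i) - q i))"
proof (induction n)
  case (Suc n)
  have "map q [0..<Suc (Suc n)] = map q [0..<n] @ [q n, q (Suc n)]" by simp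
  then show ?case using Suc energy_snoc[of f "map q [0..<n]"] by simp
qed simp

text \<open>The endpoint \<open>q n\<close> stays outside \<open>xs\<close>, so that the induction
  step only appends \<open>t n\<close> and \<open>q (Suc n)\<close>.\<close>

lemma interleaved_partition:
  assumes "\<And>i. i < n \<Longrightarrow> q i < t i" "\<And>i. i < n \<Longrightarrow> t i < q (Suc i)"
  defines "xs \<equiv> concat (map (\<lambda>i. [q i, t i]) [0..<n])"
  shows "sorted_wrt (<) (xs @ [q n]) \<and> set (xs @ [q n]) \<subseteq> {q 0..q n} \<and>
    energy f (xs @ [q n]) = (\<Sum>i<n. (norm (f (t i) - f (q i)))\<^sup>2 / (t i - q i) +
      (norm (f (q (Suc i)) - f (t i)))\<^sup>2 / (q (Suc i) - t i))"
  using assms(1,2) unfolding xs_def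
proof (induction n)
  case (Suc n)
  let ?xs = "concat (map (\<lambda>i. [q i, t i]) [0..<n])"
  have eq: "concat (map (\<lambda>i. [q i, t i]) [0..<Suc n]) @ [q (Suc n)] = (?xs @ [q n]) @ [t n, q (Suc n)]"
    by simp
  note IH = Suc.IH[OF Suc.prems(1,2)[OF less_SucI]]
  have n: "q n < t n" "t n < q (Suc n)" using Suc.prems by auto
  have "sorted_wrt (<) ((?xs @ [q n]) @ [t n, q (Suc n)])"
    using IH n by (force simp: sorted_wrt_append)
  moreover have "set ((?xs @ [q n]) @ [t n, q (Suc n)]) \<subseteq> {q 0..q (Suc n)}"
    using IH n by force
  moreover have "energy f ((?xs @ [q n]) @ [t n, q (Suc n)]) =
      energy f (?xs @ [q n]) + (norm (f (t n) - f (q n)))\<^sup>2 / (t n - q n) +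
      (norm (f (q (Suc n)) - f (t n)))\<^sup>2 / (q (Suc n) - t n)"
    using energy_snoc[of f "?xs @ [q n]" "t n" "q (Suc n)"] energy_snoc[of f ?xs "q n" "t n"] by simp
  ultimately show ?case unfolding eq using IH by simp
qed auto

text \<open>All intervals are split at once. The single gap between \<open>S\<close> and the energy
  of the partition therefore pays for the squared deviations of all intervals together.\<close>

lemma energy_gain:
  assumes q: "\<And>i. i < n \<Longrightarrow> q i < t i" "\<And>i. i < n \<Longrightarrow> t i < q (Suc i)"
    and S: "\<And>xs. sorted_wrt (<) xs \<Longrightarrow> set xs \<subseteq> {q 0..q n} \<Longrightarrow> energy f xs \<le> S"
  shows "energy f (map q [0..<Suc n]) +
    (\<Sum>i<n. 4 * (norm (chord_deviation f (q i) (q (Suc i)) (t i)))\<^sup>2 / (q (Suc i) - q i)) \<le> S"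
proof -
  have "energy f (map q [0..<Suc n]) +
      (\<Sum>i<n. 4 * (norm (chord_deviation f (q i) (q (Suc i)) (t i)))\<^sup>2 / (q (Suc i) - q i)) \<le>
    (\<Sum>i<n. (norm (f (t i) - f (q i)))\<^sup>2 / (t i - q i) +
      (norm (f (q (Suc i)) - f (t i)))\<^sup>2 / (q (Suc i) - t i))"
    unfolding energy_map_upt sum.distrib[symmetric] by (intro sum_mono energy_split) (use q in auto)
  also have "\<dots> = energy f (concat (map (\<lambda>i. [q i, t i]) [0..<n]) @ [q n])"
    using interleaved_partition[of n q t f, OF q] by simp
  also have "\<dots> \<le> S"
    using interleaved_partition[of n q t f, OF q] by (intro S) auto
  finally show ?thesis .
qed

lemma chord_deviation_max:
  assumes "a < b" "continuous_on {a..b} f"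
  obtains t where "a < t" "t < b"
    "\<And>s. s \<in> {a..b} \<Longrightarrow> norm (chord_deviation f a b s) \<le> norm (chord_deviation f a b t)"
proof -
  have "continuous_on {a..b} (\<lambda>s. norm (chord_deviation f a b s))"
    unfolding chord_deviation_def divide_inverse by (intro continuous_intros assms(2))
  then obtain m where m: "m \<in> {a..b}"
    "\<And>s. s \<in> {a..b} \<Longrightarrow> norm (chord_deviation f a b s) \<le> norm (chord_deviation f a b m)"
    using continuous_attains_sup[of "{a..b}" "\<lambda>s. norm (chord_deviation f a b s)"] \<open>a < b\<close> by auto
  show ?thesis
  proof (cases "m = a \<or> m = b")
    \<comment> \<open>At an endpoint the deviation is 0, so a maximum there forces it to vanish
      throughout and the midpoint serves as interior maximum.\<close>
    case True
    then have "chord_deviation f a b m = 0" using \<open>a < b\<close> by (auto simp: chord_deviation_def)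
    then have "norm (chord_deviation f a b s) \<le> norm (chord_deviation f a b ((a + b) / 2))"
      if "s \<in> {a..b}" for s
      using m(2)[OF that] by (metis norm_ge_zero norm_zero order_trans)
    then show ?thesis using that[of "(a + b) / 2"] \<open>a < b\<close> by auto
  next
    case False
    then show ?thesis using that[of m] m by auto
  qed
qed


section \<open>Height along a nearly straight Lipschitz curve\<close>

text \<open>Over \<open>N\<close> equal pieces the linear errors add up to
  \<open>K * (b - a)\<close> and the quadratic ones to \<open>K' * (b - a)^2 / N\<close>, which
  tends to 0.\<close>

lemma abs_diff_le_of_quadratic_increments:
  fixes Z :: "real \<Rightarrow> real"
  assumes "a \<le> b"
    and Z: "\<And>x y. a \<le> x \<Longrightarrow> x \<le> y \<Longrightarrow> y \<le> b \<Longrightarrow> \<bar>Z y - Z x\<bar> \<le> K * (y - x) + K' * (y - x)\<^sup>2"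
  shows "\<bar>Z b - Z a\<bar> \<le> K * (b - a)"
proof -
  have bound: "\<bar>Z b - Z a\<bar> \<le> K * (b - a) + K' * (b - a)\<^sup>2 / real (Suc n)" for n
  proof -
    define h where "h = (b - a) / real (Suc n)"
    have h: "h \<ge> 0" "a + real (Suc n) * h = b" using \<open>a \<le> b\<close> by (auto simp: h_def)
    have "\<bar>Z (a + real k * h) - Z a\<bar> \<le> real k * (K * h + K' * h\<^sup>2)" if "k \<le> Suc n" for k
      using that
    proof (induction k)
      case (Suc k)
      have "a + real (Suc k) * h \<le> b" using Suc.prems h by (metis add_left_mono mult_right_mono of_nat_le_iff)
      then have "\<bar>Z (a + real (Suc k) * h) - Z (a + real k * h)\<bar> \<le> K * h + K' * h\<^sup>2"
        using Z[of "a + real k * h" "a + real (Suc k) * h"] h(1) by (simp add: algebra_simps)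
      then show ?case using Suc by (simp add: algebra_simps)
    qed simp
    from this[of "Suc n"] have "\<bar>Z b - Z a\<bar> \<le> real (Suc n) * (K * h + K' * h\<^sup>2)"
      using h(2) by simp
    also have "\<dots> = K * (b - a) + K' * (b - a)\<^sup>2 / real (Suc n)"
      by (simp add: h_def field_simps power2_eq_square del: of_nat_Suc)
    finally show ?thesis .
  qed
  have "(\<lambda>n. K * (b - a) + K' * (b - a)\<^sup>2 / real (Suc n)) \<longlonglongrightarrow> K * (b - a) + 0"
    by (intro tendsto_intros LIMSEQ_Suc[OF lim_const_over_n])
  then show ?thesis
    using bound by (intro LIMSEQ_le_const[where X = "\<lambda>n. K * (b - a) + K' * (b - a)\<^sup>2 / real (Suc n)"]) auto
qed

lemma wedge_simps:
  "wedge (u + v) w = wedge u w + wedge v w" "wedge u (v + w) = wedge u v + wedge u w"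
  "wedge (u - v) w = wedge u w - wedge v w" "wedge u (v - w) = wedge u v - wedge u w"
  "wedge (r *\<^sub>R u) v = r * wedge u v" "wedge u (r *\<^sub>R v) = r * wedge u v" "wedge u u = 0"
  by (auto simp: wedge_def algebra_simps)

lemma wedge_commute: "wedge v u = - wedge u v"
  by (simp add: wedge_def)

text \<open>Heights add up along \<open>p\<close>, \<open>q\<close>, \<open>r\<close> except for the
  signed area of the projected triangle.\<close>

lemma heis_height_diff:
  "heis_height p r - heis_height p q =
    heis_height q r + wedge (hproj q - hproj p) (hproj r - hproj p) / 2"
  using wedge_commute[of "hproj p" "hproj q"] by (simp add: heis_height_def wedge_simps field_simps)

text \<open>Formally the height from \<open>h a\<close> has derivative
  \<open>wedge (f - f a) f' / 2\<close> with \<open>f - f a = (t - a) w + e\<close>. Its term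
  \<open>(t - a) wedge w e' / 2\<close> need not be small, so it is integrated by parts:
  \<open>Z\<close> subtracts \<open>(t - a) wedge w e / 2\<close> and has derivative
  \<open>- wedge w e + wedge e e' / 2\<close>, of size at most \<open>2 C \<delta>\<close>. The
  proof works with increments in place of derivatives.\<close>

lemma heis_height_le_chord_deviation:
  fixes h :: "real \<Rightarrow> heis"
  defines "f \<equiv> \<lambda>t. hproj (h t)"
  assumes lip: "\<And>s t. s \<in> {a..b} \<Longrightarrow> t \<in> {a..b} \<Longrightarrow> heis_dist (h s) (h t) \<le> C * \<bar>s - t\<bar>"
    and C: "0 \<le> C" and "a < b"
    and dev: "\<And>s. s \<in> {a..b} \<Longrightarrow> norm (chord_deviation f a b s) \<le> \<delta>"
    and s: "s \<in> {a..b}"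
  shows "\<bar>heis_height (h a) (h s)\<bar> \<le> 5 / 2 * C * (b - a) * \<delta>"
proof -
  define w where "w = (1 / (b - a)) *\<^sub>R (f b - f a)"
  define e where "e t = chord_deviation f a b t" for t
  define Z where "Z t = heis_height (h a) (h t) - (t - a) * wedge w (e t) / 2" for t
  have flip: "norm (f t - f s) \<le> C * \<bar>s - t\<bar>" if "s \<in> {a..b}" "t \<in> {a..b}" for s t
    using hproj_le_heis_dist[of "h t" "h s"] lip[OF that] by (simp add: f_def)
  have "norm (f b - f a) \<le> C * (b - a)" using flip[of a b] \<open>a < b\<close> by simp
  then have w: "norm w \<le> C" using \<open>a < b\<close> by (simp add: w_def divide_simps)
  have fe: "f t - f a = (t - a) *\<^sub>R w + e t" for t
    by (simp add: w_def e_def chord_deviation_def)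
  have \<delta>: "0 \<le> \<delta>" using dev[OF s] norm_ge_zero order_trans by blast
  have inc: "\<bar>Z y - Z x\<bar> \<le> (2 * C * \<delta>) * (y - x) + (C\<^sup>2 / 2) * (y - x)\<^sup>2"
    if xy: "a \<le> x" "x \<le> y" "y \<le> s" for x y
  proof -
    have m: "x \<in> {a..b}" "y \<in> {a..b}" using xy s by auto
    have "Z y - Z x = heis_height (h x) (h y) + wedge (f x - f a) (f y - f a) / 2
        - (y - a) * wedge w (e y) / 2 + (x - a) * wedge w (e x) / 2"
      using heis_height_diff[of "h a" "h y" "h x"] by (simp add: Z_def f_def)
    also have "\<dots> = heis_height (h x) (h y) - ((y - x) * wedge w (e y)) / 2
        - ((y - x) * wedge w (e x)) / 2 + wedge (e x) (e y - e x) / 2"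
      unfolding fe using wedge_commute[of w "e x"] by (simp add: wedge_simps field_simps)
    finally have eq: "Z y - Z x = heis_height (h x) (h y) - ((y - x) * wedge w (e y)) / 2
        - ((y - x) * wedge w (e x)) / 2 + wedge (e x) (e y - e x) / 2" .
    \<comment> \<open>The height between the nearby points \<open>h x\<close> and \<open>h y\<close>
      is of second order in \<open>y - x\<close> and disappears in the limit of
      \<open>abs_diff_le_of_quadratic_increments\<close>.\<close>
    have "(heis_dist (h x) (h y))\<^sup>2 \<le> (C * (y - x))\<^sup>2"
      using lip[OF m] xy heis_dist_nonneg by (intro power_mono) auto
    then have 1: "\<bar>heis_height (h x) (h y)\<bar> \<le> (C\<^sup>2 / 2) * (y - x)\<^sup>2"
      using heis_height_le_heis_dist[of "h x" "h y"] by (simp add: power_mult_distrib)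
    have we: "\<bar>(y - x) * wedge w (e t)\<bar> \<le> (y - x) * (C * \<delta>)" if "t \<in> {a..b}" for t
    proof -
      have "\<bar>wedge w (e t)\<bar> \<le> norm w * norm (e t)" by (rule abs_wedge_le)
      also have "\<dots> \<le> C * \<delta>" using w dev[OF that] C by (intro mult_mono) (auto simp: e_def)
      finally show ?thesis using xy by (simp add: abs_mult mult_left_mono)
    qed
    have "e y - e x = ((f y - f a) - (y - a) *\<^sub>R w) - ((f x - f a) - (x - a) *\<^sub>R w)"
      unfolding fe by simp
    also have "\<dots> = (f y - f x) - (y - x) *\<^sub>R w" by (simp add: algebra_simps)
    finally have "norm (e y - e x) \<le> norm (f y - f x) + (y - x) * norm w"
      using xy norm_triangle_ineq4[of "f y - f x" "(y - x) *\<^sub>R w"] by simp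
    also have "\<dots> \<le> C * (y - x) + (y - x) * C"
      using flip[OF m] w xy by (intro add_mono mult_left_mono) auto
    finally have "norm (e y - e x) \<le> 2 * C * (y - x)" by simp
    then have "norm (e x) * norm (e y - e x) \<le> \<delta> * (2 * C * (y - x))"
      using dev[OF m(1)] \<delta> by (intro mult_mono) (auto simp: e_def)
    then have 2: "\<bar>wedge (e x) (e y - e x)\<bar> \<le> 2 * ((y - x) * (C * \<delta>))"
      using order_trans[OF abs_wedge_le] by (simp add: mult_ac)
    have "(2 * C * \<delta>) * (y - x) = 2 * ((y - x) * (C * \<delta>))" by simp
    then show ?thesis unfolding eq using 1 we[OF m(1)] we[OF m(2)] 2 by linarith
  qed
  have "\<bar>Z s - Z a\<bar> \<le> (2 * C * \<delta>) * (s - a)"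
    by (rule abs_diff_le_of_quadratic_increments[where K' = "C\<^sup>2 / 2"]) (use s inc in auto)
  also have "\<dots> \<le> (2 * C * \<delta>) * (b - a)" using s C \<delta> by (intro mult_left_mono) auto
  finally have Zs: "\<bar>Z s - Z a\<bar> \<le> (2 * C * \<delta>) * (b - a)" .
  have Za: "Z a = 0" by (simp add: Z_def heis_height_def wedge_simps)
  \<comment> \<open>Half of this is the term subtracted in \<open>Z\<close>; with the 2 from the
    increments it yields 5/2.\<close>
  have "\<bar>(s - a) * wedge w (e s)\<bar> \<le> (b - a) * (C * \<delta>)"
  proof -
    have "\<bar>wedge w (e s)\<bar> \<le> norm w * norm (e s)" by (rule abs_wedge_le)
    also have "\<dots> \<le> C * \<delta>" using w dev[OF s] C by (intro mult_mono) (auto simp: e_def)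
    finally show ?thesis unfolding abs_mult using s by (intro mult_mono) auto
  qed
  moreover have "(2 * C * \<delta>) * (b - a) = 2 * ((b - a) * (C * \<delta>))"
    "5 / 2 * C * (b - a) * \<delta> = 5 / 2 * ((b - a) * (C * \<delta>))" by simp_all
  ultimately show ?thesis using Zs Za unfolding Z_def by linarith
qed

text \<open>The curves share their chord, so their projections differ by at most
  \<open>\<delta> + \<delta>'\<close>. The height from \<open>h s\<close> to \<open>k s\<close> is
  the difference of the heights from the common starting point minus a triangle area. The constants
  are 5/2 + 1/2 = 3 and 70 * 3 = 210.\<close>

lemma heis_dist_le_chord_deviation:
  fixes h k :: "real \<Rightarrow> heis"
  assumes lip: "\<And>s t. s \<in> {a..b} \<Longrightarrow> t \<in> {a..b} \<Longrightarrow> heis_dist (h s) (h t) \<le> C * \<bar>s - t\<bar>"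
      "\<And>s t. s \<in> {a..b} \<Longrightarrow> t \<in> {a..b} \<Longrightarrow> heis_dist (k s) (k t) \<le> C * \<bar>s - t\<bar>"
    and C: "0 \<le> C" and "a < b" and ends: "h a = k a" "h b = k b"
    and dev: "\<And>s. s \<in> {a..b} \<Longrightarrow> norm (chord_deviation (\<lambda>t. hproj (h t)) a b s) \<le> \<delta>"
      "\<And>s. s \<in> {a..b} \<Longrightarrow> norm (chord_deviation (\<lambda>t. hproj (k t)) a b s) \<le> \<delta>'"
    and s: "s \<in> {a..b}"
  shows "heis_dist (h s) (k s) \<le> 2 * (\<delta> + \<delta>') + 76 * sqrt (210 * C * (b - a) * (\<delta> + \<delta>'))"
proof -
  define v where "v = hproj (h s) - hproj (h a)"
  define d where "d = hproj (k s) - hproj (h s)"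
  have "d = chord_deviation (\<lambda>t. hproj (k t)) a b s - chord_deviation (\<lambda>t. hproj (h t)) a b s"
    by (simp add: d_def chord_deviation_def ends)
  then have d: "norm d \<le> \<delta> + \<delta>'"
    using norm_triangle_ineq4 dev[OF s] by (smt (verit, ccfv_SIG))
  have "norm v \<le> C * (s - a)"
    using hproj_le_heis_dist[of "h s" "h a"] lip(1)[of a s] s by (auto simp: v_def)
  also have "\<dots> \<le> C * (b - a)" using s C by (intro mult_left_mono) auto
  finally have "norm v * norm d \<le> C * (b - a) * (\<delta> + \<delta>')"
    using d C \<open>a < b\<close> by (intro mult_mono) auto
  then have vd: "\<bar>wedge v d\<bar> \<le> C * (b - a) * (\<delta> + \<delta>')"
    using abs_wedge_le order_trans by blast
  have "wedge v (hproj (k s) - hproj (h a)) = wedge v d"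
  proof -
    have "hproj (k s) - hproj (h a) = v + d" by (simp add: v_def d_def)
    then show ?thesis by (simp add: wedge_simps)
  qed
  then have "heis_height (h s) (k s) = heis_height (h a) (k s) - heis_height (h a) (h s) - wedge v d / 2"
    using heis_height_diff[of "h a" "k s" "h s"] by (simp add: v_def)
  moreover have "\<bar>heis_height (h a) (h s)\<bar> \<le> 5 / 2 * C * (b - a) * \<delta>"
    by (rule heis_height_le_chord_deviation[OF lip(1) C \<open>a < b\<close> dev(1) s])
  moreover have "\<bar>heis_height (h a) (k s)\<bar> \<le> 5 / 2 * C * (b - a) * \<delta>'"
    unfolding ends by (rule heis_height_le_chord_deviation[OF lip(2) C \<open>a < b\<close> dev(2) s])
  ultimately have "\<bar>heis_height (h s) (k s)\<bar> \<le> 3 * (C * (b - a) * (\<delta> + \<delta>'))"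
    using vd by (simp add: abs_le_iff algebra_simps)
  then have "sqrt (70 * \<bar>heis_height (h s) (k s)\<bar>) \<le> sqrt (210 * C * (b - a) * (\<delta> + \<delta>'))"
    by (intro real_sqrt_le_mono) (simp add: algebra_simps)
  then have "2 * norm d + 76 * sqrt (70 * \<bar>heis_height (h s) (k s)\<bar>) \<le>
      2 * (\<delta> + \<delta>') + 76 * sqrt (210 * C * (b - a) * (\<delta> + \<delta>'))"
    using d by (intro add_mono mult_left_mono) auto
  then show ?thesis
    using heis_dist_le[of "h s" "k s"] order_trans unfolding d_def by blast
qed


section \<open>Thick families\<close>

text \<open>With \<open>x = sqrt (\<Delta> / l)\<close> this says that \<open>x\<close> and \<open>x\<^sup>2\<close> are at most \<open>\<eta> + x\<^sup>4 / \<eta>\<^sup>3\<close>; the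
  term \<open>\<Delta>\<^sup>2 / l\<close> is what an energy gain controls.\<close>

lemma deviation_young:
  fixes \<Delta> l \<eta> C :: real
  assumes "0 \<le> \<Delta>" "0 < l" "0 < \<eta>" "\<eta> \<le> 1" "0 \<le> C"
  shows "2 * \<Delta> + 76 * sqrt (210 * C * l * \<Delta>) \<le>
    (2 + 76 * sqrt (210 * C)) * (\<eta> * l + \<Delta>\<^sup>2 / l / \<eta>^3)"
proof -
  define x where "x = sqrt (\<Delta> / l)"
  have x: "0 \<le> x" "\<Delta> = x\<^sup>2 * l" using assms by (auto simp: x_def)
  have "sqrt (210 * C * l * \<Delta>) = sqrt (210 * C * (x * l)\<^sup>2)"
    by (simp add: x(2) power2_eq_square mult_ac)
  also have "\<dots> = sqrt (210 * C) * (x * l)"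
    using x(1) assms(2) by (simp add: real_sqrt_mult)
  finally have sq: "sqrt (210 * C * l * \<Delta>) = sqrt (210 * C) * (x * l)" .
  have D: "\<Delta>\<^sup>2 / l = x^4 * l" using assms(2) by (simp add: x(2) field_simps eval_nat_numeral)
  have le: "x \<le> \<eta> + x^4 / \<eta>^3 \<and> x\<^sup>2 \<le> \<eta> + x^4 / \<eta>^3"
  proof (cases "x \<le> \<eta>")
    case True
    have "x * x \<le> \<eta> * 1" using True x(1) assms by (intro mult_mono) auto
    moreover have "0 \<le> x^4 / \<eta>^3" using x(1) assms by simp
    ultimately show ?thesis using True by (simp add: power2_eq_square)
  next
    case False
    then have "\<eta>^3 \<le> x^3" using assms by (intro power_mono) auto
    then have "x * \<eta>^3 \<le> x^4" using mult_left_mono[OF _ x(1)] by (fastforce simp: eval_nat_numeral)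
    then have 1: "x \<le> x^4 / \<eta>^3" using assms by (simp add: pos_le_divide_eq)
    have "\<eta>^3 \<le> \<eta>^2" using assms by (intro power_decreasing) auto
    also have "\<dots> \<le> x^2" using False assms by (intro power_mono) auto
    finally have "x^2 * \<eta>^3 \<le> x^2 * x^2" by (intro mult_left_mono) auto
    then have "x^2 * \<eta>^3 \<le> x^4" by (simp flip: power_add)
    then have "x^2 \<le> x^4 / \<eta>^3" using assms by (simp add: pos_le_divide_eq)
    then show ?thesis using 1 assms by auto
  qed
  define R where "R = \<eta> * l + \<Delta>\<^sup>2 / l / \<eta>^3"
  have R: "R = (\<eta> + x^4 / \<eta>^3) * l" by (simp add: R_def D algebra_simps)
  have "x * l \<le> R" "\<Delta> \<le> R" unfolding R x(2) using le assms(2) by (auto intro!: mult_right_mono)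
  then have "2 * \<Delta> + 76 * (sqrt (210 * C) * (x * l)) \<le> 2 * R + 76 * (sqrt (210 * C) * R)"
    using assms(5) by (intro add_mono mult_left_mono) auto
  then show ?thesis unfolding sq R_def[symmetric] by (simp add: algebra_simps)
qed

lemma partition_mono:
  fixes q :: "nat \<Rightarrow> real"
  assumes "\<And>i. i < n \<Longrightarrow> q i < q (Suc i)" "i \<le> j" "j \<le> n"
  shows "q i \<le> q j"
  using assms(2,3)
proof (induction rule: dec_induct)
  case (step k)
  then show ?case using assms(1)[of k] by simp
qed simp

text \<open>The curves meet at the partition points, so both projections have the same energy there.
  Near maximality of \<open>h\<close> thus carries over to \<open>k\<close>, and
  \<open>energy_gain\<close> applies to both.\<close>

lemma sum_heis_dist_le:
  fixes h k :: "real \<Rightarrow> heis"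
  assumes q: "\<And>i. i < n \<Longrightarrow> q i < s i" "\<And>i. i < n \<Longrightarrow> s i < q (Suc i)"
    and lip: "\<And>s t. s \<in> {q 0..q n} \<Longrightarrow> t \<in> {q 0..q n} \<Longrightarrow> heis_dist (h s) (h t) \<le> C * \<bar>s - t\<bar>"
      "\<And>s t. s \<in> {q 0..q n} \<Longrightarrow> t \<in> {q 0..q n} \<Longrightarrow> heis_dist (k s) (k t) \<le> C * \<bar>s - t\<bar>"
    and C: "0 \<le> C" and meet: "\<And>i. i \<le> n \<Longrightarrow> h (q i) = k (q i)"
    and S: "\<And>xs. sorted_wrt (<) xs \<Longrightarrow> set xs \<subseteq> {q 0..q n} \<Longrightarrow> energy (\<lambda>t. hproj (h t)) xs \<le> S"
      "\<And>xs. sorted_wrt (<) xs \<Longrightarrow> set xs \<subseteq> {q 0..q n} \<Longrightarrow> energy (\<lambda>t. hproj (k t)) xs \<le> S"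
    and near: "S - \<epsilon> \<le> energy (\<lambda>t. hproj (h t)) (map q [0..<Suc n])"
    and \<eta>: "0 < \<eta>" "\<eta> \<le> 1"
  shows "(\<Sum>i<n. heis_dist (h (s i)) (k (s i))) \<le>
    (2 + 76 * sqrt (210 * C)) * (\<eta> * (q n - q 0) + \<epsilon> / \<eta>^3)"
proof -
  define f where "f = (\<lambda>t. hproj (h t))"
  define g where "g = (\<lambda>t. hproj (k t))"
  have qq: "q i < q (Suc i)" if "i < n" for i using q[OF that] by simp
  have sub: "{q i..q (Suc i)} \<subseteq> {q 0..q n}" if "i < n" for i
    using partition_mono[of n q 0 i, OF qq] partition_mono[of n q "Suc i" n, OF qq] that by auto
  have cont: "continuous_on {q 0..q n} (\<lambda>t. hproj (u t))"
    if "\<And>s t. s \<in> {q 0..q n} \<Longrightarrow> t \<in> {q 0..q n} \<Longrightarrow> heis_dist (u s) (u t) \<le> C * \<bar>s - t\<bar>" for u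
  proof (rule lipschitz_on_continuous_on[of C], rule lipschitz_onI)
    fix s t assume "s \<in> {q 0..q n}" "t \<in> {q 0..q n}"
    then show "dist (hproj (u s)) (hproj (u t)) \<le> C * dist s t"
      using order_trans[OF hproj_le_heis_dist that] by (simp add: dist_norm norm_minus_commute)
  qed (rule C)
  have max: "\<exists>t. q i < t \<and> t < q (Suc i) \<and> (\<forall>s\<in>{q i..q (Suc i)}.
      norm (chord_deviation F (q i) (q (Suc i)) s) \<le> norm (chord_deviation F (q i) (q (Suc i)) t))"
    if "i < n" "continuous_on {q 0..q n} F" for i F
    using chord_deviation_max[OF qq[OF that(1)] continuous_on_subset[OF that(2) sub[OF that(1)]]] by metis
  \<comment> \<open>The inserted points maximise the deviation and need not be the
    \<open>s i\<close>: the height estimate needs a deviation bound on the whole interval.\<close>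
  obtain t where t: "\<And>i. i < n \<Longrightarrow> q i < t i" "\<And>i. i < n \<Longrightarrow> t i < q (Suc i)"
    "\<And>i s. i < n \<Longrightarrow> s \<in> {q i..q (Suc i)} \<Longrightarrow>
      norm (chord_deviation f (q i) (q (Suc i)) s) \<le> norm (chord_deviation f (q i) (q (Suc i)) (t i))"
    using max[OF _ cont[OF lip(1)], folded f_def] by metis
  obtain t' where t': "\<And>i. i < n \<Longrightarrow> q i < t' i" "\<And>i. i < n \<Longrightarrow> t' i < q (Suc i)"
    "\<And>i s. i < n \<Longrightarrow> s \<in> {q i..q (Suc i)} \<Longrightarrow>
      norm (chord_deviation g (q i) (q (Suc i)) s) \<le> norm (chord_deviation g (q i) (q (Suc i)) (t' i))"
    using max[OF _ cont[OF lip(2)], folded g_def] by metis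
  define l where "l i = q (Suc i) - q i" for i
  define \<delta> where "\<delta> i = norm (chord_deviation f (q i) (q (Suc i)) (t i))" for i
  define \<delta>' where "\<delta>' i = norm (chord_deviation g (q i) (q (Suc i)) (t' i))" for i
  have l: "l i > 0" if "i < n" for i using qq[OF that] by (simp add: l_def)
  have "energy f (map q [0..<Suc n]) = energy g (map q [0..<Suc n])"
    unfolding energy_map_upt by (intro sum.cong refl) (simp add: f_def g_def meet)
  then have near': "S - \<epsilon> \<le> energy f (map q [0..<Suc n])" "S - \<epsilon> \<le> energy g (map q [0..<Suc n])"
    using near by (simp_all add: f_def)
  have gain: "(\<Sum>i<n. 4 * (\<delta> i)\<^sup>2 / l i) \<le> \<epsilon>" "(\<Sum>i<n. 4 * (\<delta>' i)\<^sup>2 / l i) \<le> \<epsilon>"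
    using energy_gain[of n q t f S, OF t(1,2) S(1)[folded f_def]]
      energy_gain[of n q t' g S, OF t'(1,2) S(2)[folded g_def]] near'
    by (simp_all add: \<delta>_def \<delta>'_def l_def)
  \<comment> \<open>The right-hand side is the mean of the two gains, each at most
    \<open>\<epsilon>\<close>.\<close>
  have "(\<Sum>i<n. (\<delta> i + \<delta>' i)\<^sup>2 / l i) \<le> (\<Sum>i<n. (4 * (\<delta> i)\<^sup>2 / l i + 4 * (\<delta>' i)\<^sup>2 / l i) / 2)"
  proof (rule sum_mono)
    fix i assume "i \<in> {..<n}"
    then have "l i > 0" using l by simp
    moreover have "0 \<le> (\<delta> i - \<delta>' i)\<^sup>2" by simp
    then have "(\<delta> i + \<delta>' i)\<^sup>2 \<le> 2 * (\<delta> i)\<^sup>2 + 2 * (\<delta>' i)\<^sup>2" by (simp add: power2_eq_square algebra_simps)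
    ultimately show "(\<delta> i + \<delta>' i)\<^sup>2 / l i \<le> (4 * (\<delta> i)\<^sup>2 / l i + 4 * (\<delta>' i)\<^sup>2 / l i) / 2"
      by (simp add: field_simps)
  qed
  also have "\<dots> \<le> \<epsilon>" using gain by (simp add: sum.distrib flip: sum_divide_distrib)
  finally have total: "(\<Sum>i<n. (\<delta> i + \<delta>' i)\<^sup>2 / l i) \<le> \<epsilon>" .
  let ?K = "2 + 76 * sqrt (210 * C)"
  have "heis_dist (h (s i)) (k (s i)) \<le> ?K * (\<eta> * l i + (\<delta> i + \<delta>' i)\<^sup>2 / l i / \<eta>^3)" if i: "i < n" for i
  proof -
    note sub' = subsetD[OF sub[OF i]]
    have "heis_dist (h (s i)) (k (s i)) \<le> 2 * (\<delta> i + \<delta>' i) + 76 * sqrt (210 * C * l i * (\<delta> i + \<delta>' i))"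
      unfolding l_def
    proof (rule heis_dist_le_chord_deviation[OF lip(1)[OF sub' sub'] lip(2)[OF sub' sub'] C qq[OF i]])
      show "h (q i) = k (q i)" "h (q (Suc i)) = k (q (Suc i))" using i meet by auto
      show "norm (chord_deviation (\<lambda>t. hproj (h t)) (q i) (q (Suc i)) s) \<le> \<delta> i"
        "norm (chord_deviation (\<lambda>t. hproj (k t)) (q i) (q (Suc i)) s) \<le> \<delta>' i"
        if "s \<in> {q i..q (Suc i)}" for s
        using t(3)[OF i that] t'(3)[OF i that] by (simp_all add: \<delta>_def \<delta>'_def f_def g_def)
      show "s i \<in> {q i..q (Suc i)}" using q[OF i] by simp
    qed
    also have "\<dots> \<le> ?K * (\<eta> * l i + (\<delta> i + \<delta>' i)\<^sup>2 / l i / \<eta>^3)"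
      by (rule deviation_young) (use l[OF i] \<eta> C in \<open>auto simp: \<delta>_def \<delta>'_def\<close>)
    finally show ?thesis .
  qed
  then have "(\<Sum>i<n. heis_dist (h (s i)) (k (s i))) \<le>
      (\<Sum>i<n. ?K * (\<eta> * l i + (\<delta> i + \<delta>' i)\<^sup>2 / l i / \<eta>^3))"
    by (intro sum_mono) auto
  also have "\<dots> = ?K * (\<eta> * (\<Sum>i<n. l i) + (\<Sum>i<n. (\<delta> i + \<delta>' i)\<^sup>2 / l i) / \<eta>^3)"
    by (simp only: sum_distrib_left[symmetric] sum_divide_distrib[symmetric] sum.distrib)
  also have "(\<Sum>i<n. l i) = q n - q 0"
    unfolding l_def by (rule sum_lessThan_telescope)
  also have "?K * (\<eta> * (q n - q 0) + (\<Sum>i<n. (\<delta> i + \<delta>' i)\<^sup>2 / l i) / \<eta>^3) \<le>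
      ?K * (\<eta> * (q n - q 0) + \<epsilon> / \<eta>^3)"
    using total \<eta> C by (intro mult_left_mono add_left_mono divide_right_mono) auto
  finally show ?thesis .
qed

section \<open>Contradiction between thickness and energy\<close>

theorem mainTheorem3:
  fixes M :: "'a set" and d :: "'a \<Rightarrow> 'a \<Rightarrow> real"
  assumes "Metric_space M d"
    and "contains_thick_family M d"
  shows "\<not> (\<exists>F :: 'a \<Rightarrow> heis. bilipschitz_embedding M d (UNIV :: heis set) heis_dist F)"
proof
  assume "\<exists>F :: 'a \<Rightarrow> heis. bilipschitz_embedding M d (UNIV :: heis set) heis_dist F"
  then obtain F :: "'a \<Rightarrow> heis" and c C where cC: "0 < c" "c \<le> C"
    and F: "\<And>x y. x \<in> M \<Longrightarrow> y \<in> M \<Longrightarrow> c * d x y \<le> heis_dist (F x) (F y)"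
      "\<And>x y. x \<in> M \<Longrightarrow> y \<in> M \<Longrightarrow> heis_dist (F x) (F y) \<le> C * d x y"
    unfolding bilipschitz_embedding_def by blast
  have C: "0 \<le> C" using cC by simp
  obtain u v T where T: "thick_family M d u v T"
    using assms(2) unfolding contains_thick_family_def by blast
  then obtain \<alpha> where "\<alpha> > 0" and \<alpha>: "\<forall>g\<in>T. \<forall>R. finite R \<and> R \<subseteq> {0..d u v} \<longrightarrow>
      (\<exists>g'\<in>T. g' \<noteq> g \<and> (\<exists>(m::nat) (s :: nat \<Rightarrow> real) (q :: nat \<Rightarrow> real).
        0 < s 1 \<and> (\<forall>i\<in>{1..m}. s i < q i \<and> q i < s (i + 1)) \<and> s (m + 1) < d u v \<and>
        R \<subseteq> {0, d u v} \<union> q ` {1..m} \<and>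
        (\<forall>i\<in>{1..m}. g (q i) = g' (q i)) \<and>
        (\<Sum>i=1..m+1. d (g (s i)) (g' (s i))) \<ge> \<alpha>))"
    unfolding thick_family_def by (elim conjE exE) (rule that; assumption)
  from T have "T \<noteq> {}"
    unfolding thick_family_def by (elim conjE)
  from T have T_geo: "\<forall>g\<in>T. is_geodesic M d u v g"
    unfolding thick_family_def by (elim conjE)
  define L where "L = d u v"
  have L: "0 \<le> L" using Metric_space.nonneg[OF assms(1)] by (simp add: L_def)
  have geo: "g t \<in> M" "heis_dist (F (g s)) (F (g t)) \<le> C * \<bar>s - t\<bar>" "g 0 = u" "g L = v"
    if "g \<in> T" "s \<in> {0..L}" "t \<in> {0..L}" for g s t
  proof -
    have "is_geodesic M d u v g" using T_geo that(1) ..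
    then have g: "\<And>t. t \<in> {0..L} \<Longrightarrow> g t \<in> M" "d (g s) (g t) = \<bar>s - t\<bar>" "g 0 = u" "g L = v"
      using that(2,3) unfolding is_geodesic_def L_def by auto
    then show "g t \<in> M" "heis_dist (F (g s)) (F (g t)) \<le> C * \<bar>s - t\<bar>" "g 0 = u" "g L = v"
      using F(2)[of "g s" "g t"] that by auto
  qed
  \<comment> \<open>The supremum ranges over all geodesics of \<open>T\<close> as well as all
    partitions, so it also bounds the energies of the second geodesic.\<close>
  define E where "E = {energy (\<lambda>t. hproj (F (g t))) xs | g xs.
      g \<in> T \<and> sorted_wrt (<) xs \<and> set xs \<subseteq> {0..L}}"
  have E_I: "energy (\<lambda>t. hproj (F (g t))) xs \<in> E"
    if "g \<in> T" "sorted_wrt (<) xs" "set xs \<subseteq> {0..L}" for g xs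
    unfolding E_def using that by blast
  have bdd: "e \<le> C\<^sup>2 * L" if "e \<in> E" for e
  proof -
    obtain g xs where e: "e = energy (\<lambda>t. hproj (F (g t))) xs" "g \<in> T" "sorted_wrt (<) xs" "set xs \<subseteq> {0..L}"
      using \<open>e \<in> E\<close> unfolding E_def by blast
    show ?thesis
    proof (cases xs)
      case Nil
      then show ?thesis using e L by simp
    next
      case (Cons x ys)
      have "e \<le> C\<^sup>2 * (last (x # ys) - x)"
        unfolding e(1) Cons
      proof (rule energy_le_lipschitz[where A = "{0..L}", OF _ C])
        fix s t assume "s \<in> {0..L}" "t \<in> {0..L}"
        then show "norm (hproj (F (g t)) - hproj (F (g s))) \<le> C * \<bar>t - s\<bar>"
          using order_trans[OF hproj_le_heis_dist geo(2)[OF e(2)]] by (simp add: abs_minus_commute)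
      qed (use e Cons in auto)
      also have "\<dots> \<le> C\<^sup>2 * L"
        using e(4) Cons last_in_set[of "x # ys"] by (intro mult_left_mono) fastforce+
      finally show ?thesis .
    qed
  qed
  obtain g0 where "g0 \<in> T" using \<open>T \<noteq> {}\<close> by blast
  then have ne: "E \<noteq> {}" using E_I[of g0 "[]"] by force
  have bddE: "bdd_above E" using bdd by (rule bdd_aboveI)
  define K where "K = 2 + 76 * sqrt (210 * C)"
  have K: "K > 0" using C by (simp add: K_def add_pos_nonneg)
  \<comment> \<open>\<open>\<eta>\<close> is fixed before \<open>\<epsilon>\<close>: the linear term
    gets a quarter of \<open>c * \<alpha>\<close>, and then \<open>\<epsilon>\<close> is chosen so
    that \<open>\<epsilon> / \<eta>^3\<close> yields another quarter. Using \<open>L + 1\<close>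
    avoids a zero denominator.\<close>
  define \<eta> where "\<eta> = min 1 (c * \<alpha> / (4 * K * (L + 1)))"
  have \<eta>: "0 < \<eta>" "\<eta> \<le> 1" using cC \<open>\<alpha> > 0\<close> K L by (auto simp: \<eta>_def)
  have \<eta>L: "K * (\<eta> * L) \<le> c * \<alpha> / 4"
  proof -
    have "\<eta> * (4 * K * (L + 1)) \<le> c * \<alpha>" using K L by (simp add: \<eta>_def pos_le_divide_eq[symmetric])
    moreover have "\<eta> * (4 * K * L) \<le> \<eta> * (4 * K * (L + 1))" using \<eta> K by (intro mult_left_mono) auto
    ultimately have "\<eta> * (4 * K * L) \<le> c * \<alpha>" by (rule order_trans[rotated])
    then show ?thesis by (simp add: mult_ac)
  qed
  define \<epsilon> where "\<epsilon> = c * \<alpha> * \<eta>^3 / (4 * K)"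
  have \<epsilon>: "\<epsilon> > 0" "K * (\<epsilon> / \<eta>^3) = c * \<alpha> / 4"
    using cC \<open>\<alpha> > 0\<close> K \<eta> by (auto simp: \<epsilon>_def)
  have "Sup E - \<epsilon> < Sup E" using \<epsilon> by simp
  then obtain e where "e \<in> E" "Sup E - \<epsilon> < e"
    using less_cSup_iff[OF ne bddE] by blast
  then obtain g xs where g: "g \<in> T" and xs: "sorted_wrt (<) xs" "set xs \<subseteq> {0..L}"
    and near: "Sup E - \<epsilon> < energy (\<lambda>t. hproj (F (g t))) xs"
    unfolding E_def by blast
  \<comment> \<open>Thickness is applied with the nearly optimal partition \<open>xs\<close> as the
    prescribed finite set.\<close>
  obtain g' m and s q :: "nat \<Rightarrow> real" where g': "g' \<in> T"
    and s: "0 < s 1" "s (m + 1) < L" "\<And>i. i \<in> {1..m} \<Longrightarrow> s i < q i" "\<And>i. i \<in> {1..m} \<Longrightarrow> q i < s (i + 1)"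
    and R: "set xs \<subseteq> {0, L} \<union> q ` {1..m}" and eq: "\<And>i. i \<in> {1..m} \<Longrightarrow> g (q i) = g' (q i)"
    and sum: "(\<Sum>i=1..m+1. d (g (s i)) (g' (s i))) \<ge> \<alpha>"
    using mp[OF spec[OF bspec[OF \<alpha>[folded L_def] g]] conjI[OF finite_set xs(2)]]
    by (elim bexE exE conjE) (rule that, (assumption | blast)+)
  \<comment> \<open>The \<open>m\<close> meeting points and the two endpoints bound
    \<open>m + 1\<close> intervals. They are numbered from 0, so the interval from
    \<open>Q i\<close> to \<open>Q (Suc i)\<close> contains \<open>s (Suc i)\<close>.\<close>
  define n where "n = Suc m"
  define Q where "Q i = (if i = 0 then 0 else if i \<le> m then q i else L)" for i
  have Q0: "Q 0 = 0" and Qn: "Q n = L" by (auto simp: Q_def n_def)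
  have Qs: "Q i < s (Suc i)" if "i < n" for i
    using s(1) s(4)[of i] that by (auto simp: Q_def n_def)
  have sQ: "s (Suc i) < Q (Suc i)" if "i < n" for i
    using s(2) s(3)[of "Suc i"] that by (cases "i = m") (auto simp: Q_def n_def)
  have QQ: "Q i < Q (Suc i)" if "i < n" for i using Qs[OF that] sQ[OF that] by simp
  have QL: "Q i \<in> {0..L}" if "i \<le> n" for i
    using partition_mono[of n Q 0 i, OF QQ] partition_mono[of n Q i n, OF QQ] that Q0 Qn by simp
  have L0: "0 \<in> {0..L}" "L \<in> {0..L}" using L by auto
  have meet: "F (g (Q i)) = F (g' (Q i))" if "i \<le> n" for i
    using eq[of i] geo(3,4)[OF g L0] geo(3,4)[OF g' L0] by (auto simp: Q_def)
  have S: "energy (\<lambda>t. hproj (F (k t))) ys \<le> Sup E"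
    if "k \<in> T" "sorted_wrt (<) ys" "set ys \<subseteq> {Q 0..Q n}" for k ys
    using that by (intro cSup_upper[OF _ bddE] E_I) (auto simp: Q0 Qn)
  \<comment> \<open>The points \<open>Q i\<close> include all of \<open>xs\<close>, and refinement
    does not lower the energy.\<close>
  have near': "Sup E - \<epsilon> \<le> energy (\<lambda>t. hproj (F (g t))) (map Q [0..<Suc n])"
  proof -
    have sorted: "sorted_wrt (<) (map Q [0..<Suc n])"
    proof -
      have "Q i < Q j" if "i < j" "j \<le> n" for i j
        using QQ[of i] partition_mono[of n Q "Suc i" j, OF QQ] that by simp
      then show ?thesis by (auto simp: sorted_wrt_iff_nth_less simp del: upt_Suc)
    qed
    have "set xs \<subseteq> Q ` {..n}"
    proof
      fix x assume "x \<in> set xs"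
      with R consider "x = Q 0" | "x = Q n" | i where "i \<in> {1..m}" "x = Q i"
        using Q0 Qn by (auto simp: Q_def)
      then show "x \<in> Q ` {..n}" by cases (auto simp: n_def)
    qed
    then have sub: "set xs \<subseteq> set (map Q [0..<Suc n])"
      by (simp add: atLeast0LessThan lessThan_Suc_atMost del: upt_Suc)
    have "energy (\<lambda>t. hproj (F (g t))) xs \<le> energy (\<lambda>t. hproj (F (g t))) (map Q [0..<Suc n])"
      by (rule energy_mono[OF xs(1) sorted sub])
    then show ?thesis using near by simp
  qed
  have "\<alpha> \<le> (\<Sum>i<n. d (g (s (Suc i))) (g' (s (Suc i))))"
    using sum by (simp add: n_def sum.atLeast1_atMost_eq)
  then have "c * \<alpha> \<le> (\<Sum>i<n. c * d (g (s (Suc i))) (g' (s (Suc i))))"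
    using cC by (simp add: sum_distrib_left[symmetric])
  also have "\<dots> \<le> (\<Sum>i<n. heis_dist (F (g (s (Suc i)))) (F (g' (s (Suc i)))))"
  proof (intro sum_mono F(1))
    fix i assume "i \<in> {..<n}"
    then have "s (Suc i) \<in> {0..L}"
      using Qs[of i] sQ[of i] QL[of i] QL[of "Suc i"] by auto
    then show "g (s (Suc i)) \<in> M" "g' (s (Suc i)) \<in> M" using geo(1) g g' by blast+
  qed
  also have "\<dots> \<le> K * (\<eta> * (Q n - Q 0) + \<epsilon> / \<eta>^3)"
    unfolding K_def
    by (rule sum_heis_dist_le[of n Q "\<lambda>i. s (Suc i)" "\<lambda>t. F (g t)" C "\<lambda>t. F (g' t)" "Sup E", OF Qs sQ])
      (use geo(2)[OF g] geo(2)[OF g'] Q0 Qn C meet S[OF g] S[OF g'] near' \<eta> in auto)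
  also have "\<dots> = K * (\<eta> * L) + K * (\<epsilon> / \<eta>^3)"
    by (simp add: Q0 Qn distrib_left)
  also have "\<dots> < c * \<alpha>"
    using \<eta>L \<epsilon>(2) mult_pos_pos[OF cC(1) \<open>\<alpha> > 0\<close>] by linarith
  finally show False by simp
qed

end
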